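(* Let $\ell\ge 1$ be an integer and let $(u_1^0,\dots,u_\ell^0)$ satisfy $u_n^0\ge 0$ and $\sum_{n=1}^{\ell}u_n^0=1$. Then the system $$\dot u_n = \sum_{i = n}^{\ell} \frac{i(n+\ell-i)}{M}u_i u_{n+\ell - i} - 2nu_n\sum_{i = 1+ \ell-n}^{\ell} \frac{iu_i}{M},\qquad 1\le n\le \ell,\qquad M = \sum_{i = 1}^\ell \sum_{j = 1+\ell-i}^\ell iju_iu_j,$$ with initial conditions $u_n(0)=u_n^0$ has a unique small-cluster solution $u=(u_1,\dots,u_\ell)$ on $[0,t_{\mathrm{ex}})$, where $t_{\mathrm{ex}}=\inf\{s\ge 0: M(s^-)=0\}$ is the exhaustion time of the solution. Moreover, this solution is (real) analytic on $[0,t_{\mathrm{ex}})$.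
   Context: A small-cluster solution on an interval is a solution $u=(u_1,\dots,u_\ell)$ of the displayed system with the given initial conditions such that each $u_k$ is $C^1$ with values in $[0,1]$ (in particular nonnegative); on a half-open interval $[0,t_{\mathrm{ex}})$ this is required on $[0,T]$ for every $0<T<t_{\mathrm{ex}}$. Since $M$ occurs in denominators, being a solution includes $M\neq 0$ along it. $M(s^-)$ is the left limit at $s$ of $M$ evaluated along the solution, read as $M(0)$ when $s=0$; so $t_{\mathrm{ex}}$ is the first time at which $M$ tends to $0$ along the solution (the interval is empty if $M(0)=0$). *)

theory Defs
  imports "HOL-Analysis.Analysis"
begin

text \<open>A state is a function \<^typ>\<open>nat \<Rightarrow> real\<close>, of which only the entries with index in
  \<open>{1..l}\<close> matter.\<close>

definition M :: "nat \<Rightarrow> (nat \<Rightarrow> real) \<Rightarrow> real" where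
  "M l x = (\<Sum>i = 1..l. \<Sum>j = 1 + l - i..l. real i * real j * x i * x j)"

definition rhs :: "nat \<Rightarrow> (nat \<Rightarrow> real) \<Rightarrow> nat \<Rightarrow> real" where
  "rhs l x n =
     (\<Sum>i = n..l. real i * real (n + l - i) / M l x * x i * x (n + l - i))
     - 2 * real n * x n * (\<Sum>i = 1 + l - n..l. real i * x i / M l x)"

text \<open>Derivatives are taken within the interval, so they are one-sided at its end points and the
  values of a total function outside the interval are irrelevant.\<close>

definition C1_on :: "(real \<Rightarrow> real) \<Rightarrow> real set \<Rightarrow> bool" where
  "C1_on f S \<longleftrightarrow>
     (\<exists>f'. continuous_on S f' \<and> (\<forall>t\<in>S. (f has_real_derivative f' t) (at t within S)))"

definition small_cluster_solution_closed ::
  "nat \<Rightarrow> (nat \<Rightarrow> real) \<Rightarrow> (real \<Rightarrow> nat \<Rightarrow> real) \<Rightarrow> real \<Rightarrow> bool" where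
  "small_cluster_solution_closed l u0 u T \<longleftrightarrow>
     (\<forall>n\<in>{1..l}. u 0 n = u0 n) \<and>
     (\<forall>t\<in>{0..T}. M l (u t) \<noteq> 0) \<and>
     (\<forall>n\<in>{1..l}.
        C1_on (\<lambda>t. u t n) {0..T} \<and>
        (\<forall>t\<in>{0..T}. u t n \<in> {0..1}) \<and>
        (\<forall>t\<in>{0..T}. ((\<lambda>t. u t n) has_real_derivative rhs l (u t) n) (at t within {0..T})))"

text \<open>The solution on \<open>[0, \<tau>)\<close>, with \<open>\<tau> = \<infinity>\<close> allowed. The initial condition is imposed separately
  because \<open>u 0\<close> is still used, to evaluate \<open>M\<close> at time 0, when \<open>\<tau> = 0\<close> and the interval is empty.\<close>

definition small_cluster_solution ::
  "nat \<Rightarrow> (nat \<Rightarrow> real) \<Rightarrow> (real \<Rightarrow> nat \<Rightarrow> real) \<Rightarrow> ereal \<Rightarrow> bool" where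
  "small_cluster_solution l u0 u \<tau> \<longleftrightarrow>
     (\<forall>n\<in>{1..l}. u 0 n = u0 n) \<and>
     (\<forall>T. 0 < T \<and> ereal T < \<tau> \<longrightarrow> small_cluster_solution_closed l u0 u T)"

definition M_left_limit_zero :: "nat \<Rightarrow> (real \<Rightarrow> nat \<Rightarrow> real) \<Rightarrow> real \<Rightarrow> bool" where
  "M_left_limit_zero l u s \<longleftrightarrow>
     (if s = 0 then M l (u 0) = 0 else ((\<lambda>t. M l (u t)) \<longlongrightarrow> 0) (at_left s))"

text \<open>The exhaustion time of a solution living on \<open>[0, \<tau>)\<close>. Left limits along the solution only
  make sense for \<open>s \<le> \<tau>\<close>; later values of the total function \<open>u\<close> must not count. The infimum of
  the empty set is \<open>\<infinity>\<close>.\<close>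

definition exhaustion_time :: "nat \<Rightarrow> (real \<Rightarrow> nat \<Rightarrow> real) \<Rightarrow> ereal \<Rightarrow> ereal" where
  "exhaustion_time l u \<tau> = Inf (ereal ` {s. 0 \<le> s \<and> ereal s \<le> \<tau> \<and> M_left_limit_zero l u s})"

text \<open>Local power series expansions relative to \<open>S\<close>: at an end point of an interval belonging to
  \<open>S\<close> this says that the function has an analytic extension across that point.\<close>

definition real_analytic_on :: "(real \<Rightarrow> real) \<Rightarrow> real set \<Rightarrow> bool" where
  "real_analytic_on f S \<longleftrightarrow>
     (\<forall>x\<in>S. \<exists>a r. 0 < r \<and>
        (\<forall>t\<in>S. \<bar>t - x\<bar> < r \<longrightarrow> (\<lambda>k. a k * (t - x) ^ k) sums f t))"

end

theory Submission
  imports Defs "HOL-Complex_Analysis.Complex_Analysis"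
begin

text \<open>Read the dynamics as the reaction \<open>(i, m) \<rightarrow> (i + m - l, 0)\<close> for \<open>i + m > l\<close>, with an
  additional component \<open>u\<^sub>0\<close> collecting the clusters of size 0. Each reaction preserves the number
  of clusters and \<open>M\<close> is the total rate, so the total mass of \<open>u\<^sub>0, \<dots>, u\<^sub>l\<close> stays 1 and \<open>u\<^sub>0(t) = t\<close>.
  After the time change \<open>d\<sigma> = dt / M\<close> the system is quadratic, and the further change
  \<open>r = 1 - exp (- C \<sigma>)\<close> with \<open>C = 2 l\<^sup>2\<close> solves it globally by a Wild sum
  \<open>w\<^sub>n(r) = (1 - r) \<Sum>\<^sub>k a\<^sub>k\<^sub>n r\<^sup>k\<close>, \<open>0 \<le> r < 1\<close>, whose coefficients are probability vectors in \<open>n\<close>.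
  Hence \<open>w\<close> is nonnegative, \<open>M > 0\<close> along it, and \<open>t = w\<^sub>0(r)\<close> is an increasing analytic function
  of \<open>r\<close>, so that \<open>u(t) = w(w\<^sub>0\<^sup>-\<^sup>1(t))\<close> is analytic. As \<open>r \<rightarrow> 1\<close>, \<open>M\<close> must tend to 0, since otherwise
  \<open>t\<close> would grow like \<open>- ln (1 - r)\<close>, but \<open>t = w\<^sub>0 \<le> 1\<close>. Uniqueness is Gronwall's inequality away
  from \<open>M = 0\<close>.\<close>

subsection \<open>The system as a reaction network\<close>

text \<open>\<open>rate l n i m\<close> is the signed contribution of the reaction of \<open>i\<close> with \<open>m\<close> to component \<open>n\<close>. The
  factor 2 charges both losses to the first reactant, which is harmless by the symmetry in \<open>i, m\<close>.\<close>

definition rate :: "nat \<Rightarrow> nat \<Rightarrow> nat \<Rightarrow> nat \<Rightarrow> real" where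
  "rate l n i m = (if l < i + m then real i * real m else 0) *
     (of_bool (n = i + m - l) + of_bool (n = 0) - 2 * of_bool (n = i))"

definition drift :: "nat \<Rightarrow> (nat \<Rightarrow> real) \<Rightarrow> nat \<Rightarrow> real" where
  "drift l x n = (\<Sum>i\<le>l. \<Sum>m\<le>l. rate l n i m * x i * x m)"

lemma tail_sum_eq:
  fixes f :: "nat \<Rightarrow> real"
  assumes "n \<le> l"
  shows "(\<Sum>i = 1 + l - n..l. f i) = (\<Sum>i\<le>l. of_bool (l < n + i) * f i)"
  using assms by (intro sum.mono_neutral_cong_left) auto

text \<open>Moving the condition \<open>l < i + m\<close> from the range into the coefficient gives
  \<open>M\<close> the same shape as \<open>drift\<close>. Index 0 adds nothing because of the
  factors \<open>real i\<close> and \<open>real m\<close>.\<close>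

lemma M_eq: "M l x = (\<Sum>i\<le>l. \<Sum>m\<le>l. (if l < i + m then real i * real m else 0) * x i * x m)"
proof -
  have "M l x = (\<Sum>i = 1..l. \<Sum>m\<le>l. (if l < i + m then real i * real m else 0) * x i * x m)"
    unfolding M_def
  proof (rule sum.cong[OF refl])
    fix i assume "i \<in> {1..l}"
    then show "(\<Sum>j = 1 + l - i..l. real i * real j * x i * x j) =
        (\<Sum>m\<le>l. (if l < i + m then real i * real m else 0) * x i * x m)"
      by (subst tail_sum_eq) (auto intro: sum.cong simp del: sum_of_bool_mult_eq)
  qed
  also have "\<dots> = (\<Sum>i\<le>l. \<Sum>m\<le>l. (if l < i + m then real i * real m else 0) * x i * x m)"
    by (rule sum.mono_neutral_left) auto
  finally show ?thesis .
qed

text \<open>Each reaction creates one cluster of size 0 and none is consumed: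
  \<open>l < i + m\<close> rules out \<open>i + m - l = 0\<close>, and for \<open>i = 0\<close> the
  coefficient vanishes.\<close>

lemma drift_0: "drift l x 0 = M l x"
  unfolding drift_def M_eq by (intro sum.cong refl) (auto simp: rate_def)

lemma drift_eq:
  assumes "1 \<le> n" "n \<le> l"
  shows "drift l x n = (\<Sum>i = n..l. real i * real (n + l - i) * x i * x (n + l - i))
     - 2 * real n * x n * (\<Sum>i = 1 + l - n..l. real i * x i)"
proof -
  define k where "k i m = (if l < i + m then real i * real m * x i * x m else 0)" for i m
  have "drift l x n = (\<Sum>i\<le>l. \<Sum>m\<le>l. of_bool (n = i + m - l) * k i m)
      - 2 * (\<Sum>i\<le>l. of_bool (n = i) * (\<Sum>m\<le>l. k i m))"
    unfolding drift_def sum_distrib_left sum_subtractf[symmetric]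
    using assms by (intro sum.cong refl) (auto simp: rate_def k_def)
  moreover have "(\<Sum>i\<le>l. of_bool (n = i) * (\<Sum>m\<le>l. k i m)) =
      real n * x n * (\<Sum>i = 1 + l - n..l. real i * x i)"
  proof -
    have "(\<Sum>i\<le>l. of_bool (n = i) * (\<Sum>m\<le>l. k i m)) = (\<Sum>i\<le>l. if n = i then \<Sum>m\<le>l. k i m else 0)"
      by (intro sum.cong) auto
    also have "\<dots> = (\<Sum>m\<le>l. k n m)" using assms by simp
    also have "\<dots> = real n * x n * (\<Sum>i = 1 + l - n..l. real i * x i)"
      unfolding tail_sum_eq[OF assms(2)] sum_distrib_left
      by (intro sum.cong) (auto simp: k_def)
    finally show ?thesis .
  qed
  moreover have "(\<Sum>i\<le>l. \<Sum>m\<le>l. of_bool (n = i + m - l) * k i m) =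
      (\<Sum>i = n..l. real i * real (n + l - i) * x i * x (n + l - i))"
  proof -
    \<comment> \<open>Where the condition in \<open>k\<close> holds, the truncated subtraction is
      exact, so the indicator fixes \<open>m = n + l - i\<close>; this is at most \<open>l\<close>
      exactly when \<open>n \<le> i\<close>.\<close>
    have "(\<Sum>i\<le>l. \<Sum>m\<le>l. of_bool (n = i + m - l) * k i m) =
        (\<Sum>i\<le>l. \<Sum>m\<le>l. if m = n + l - i then k i m else 0)"
      using assms by (intro sum.cong) (auto simp: k_def)
    also have "\<dots> = (\<Sum>i\<le>l. if n \<le> i then k i (n + l - i) else 0)"
      by (intro sum.cong) auto
    also have "\<dots> = (\<Sum>i = n..l. k i (n + l - i))"
      by (rule sum.mono_neutral_cong_right) auto
    also have "\<dots> = (\<Sum>i = n..l. real i * real (n + l - i) * x i * x (n + l - i))"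
      using assms by (intro sum.cong) (auto simp: k_def)
    finally show ?thesis .
  qed
  ultimately show ?thesis by simp
qed

text \<open>\<open>M\<close> is a common denominator of all terms; if it vanishes, both sides are 0
  by the convention for division.\<close>

lemma rhs_eq:
  assumes "1 \<le> n" "n \<le> l"
  shows "rhs l x n = drift l x n / M l x"
  unfolding rhs_def drift_eq[OF assms]
  by (simp add: diff_divide_distrib sum_divide_distrib sum_distrib_left mult_ac)

lemma drift_scale: "drift l (\<lambda>n. s * x n) n = s\<^sup>2 * drift l x n"
  unfolding drift_def sum_distrib_left by (intro sum.cong) (auto simp: power2_eq_square)

lemma M_nonneg: "(\<And>n. n \<le> l \<Longrightarrow> 1 \<le> n \<Longrightarrow> 0 \<le> x n) \<Longrightarrow> 0 \<le> M l x"
  unfolding M_def by (intro sum_nonneg mult_nonneg_nonneg) auto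

lemma M_mono:
  assumes "\<And>n. n \<le> l \<Longrightarrow> 1 \<le> n \<Longrightarrow> 0 \<le> x n" "\<And>n. n \<le> l \<Longrightarrow> 1 \<le> n \<Longrightarrow> x n \<le> y n"
  shows "M l x \<le> M l y"
proof -
  have "0 \<le> y n" if "n \<le> l" "1 \<le> n" for n using assms[OF that] by linarith
  then show ?thesis unfolding M_def using assms
    by (intro sum_mono mult_mono mult_nonneg_nonneg) auto
qed

text \<open>The loss term of \<open>n\<close> is twice one of the rows of \<open>M\<close>.\<close>

lemma drift_ge:
  assumes "1 \<le> n" "n \<le> l" "\<And>n. n \<le> l \<Longrightarrow> 1 \<le> n \<Longrightarrow> 0 \<le> x n"
  shows "- 2 * M l x \<le> drift l x n"
proof -
  have "0 \<le> (\<Sum>i = n..l. real i * real (n + l - i) * x i * x (n + l - i))"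
    using assms by (intro sum_nonneg mult_nonneg_nonneg assms) auto
  moreover have "real n * x n * (\<Sum>i = 1 + l - n..l. real i * x i) \<le> M l x"
  proof -
    have "(\<Sum>j = 1 + l - n..l. real n * real j * x n * x j) \<le> M l x"
      unfolding M_def using assms
      by (intro member_le_sum[where f="\<lambda>i. \<Sum>j = 1 + l - i..l. real i * real j * x i * x j"])
        (auto intro!: sum_nonneg mult_nonneg_nonneg)
    then show ?thesis by (simp add: sum_distrib_left mult_ac)
  qed
  ultimately show ?thesis unfolding drift_eq[OF assms(1,2)] by linarith
qed

subsection \<open>Wild sums\<close>

text \<open>The Taylor coefficients at 0 of the quadratic system with coefficients \<open>c\<close>
  and initial value \<open>x\<close>: the sum over \<open>j\<close> is a Cauchy product, and the
  denominator \<open>Suc k\<close> comes from differentiating \<open>r ^ Suc k\<close>.\<close>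

fun wild :: "nat \<Rightarrow> (nat \<Rightarrow> nat \<Rightarrow> nat \<Rightarrow> real) \<Rightarrow> (nat \<Rightarrow> real) \<Rightarrow> nat \<Rightarrow> nat \<Rightarrow> real" where
  "wild N c x 0 n = x n"
| "wild N c x (Suc k) n =
     (\<Sum>j\<le>k. \<Sum>i\<le>N. \<Sum>m\<le>N. c n i m * wild N c x j i * wild N c x (k - j) m) / real (Suc k)"

lemma wild_nonneg:
  assumes "\<And>n i m. n \<le> N \<Longrightarrow> i \<le> N \<Longrightarrow> m \<le> N \<Longrightarrow> 0 \<le> c n i m" "\<And>n. n \<le> N \<Longrightarrow> 0 \<le> x n" "n \<le> N"
  shows "0 \<le> wild N c x k n"
  using assms(3)
proof (induction k arbitrary: n rule: less_induct)
  case (less k)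
  then show ?case
    by (cases k) (auto intro!: divide_nonneg_nonneg sum_nonneg mult_nonneg_nonneg assms)
qed

text \<open>Summing over \<open>n\<close> turns the quadratic term into a product of total masses,
  all equal to 1 by induction; the number of summands in the Cauchy product cancels the
  denominator.\<close>

lemma wild_sum:
  assumes c: "\<And>i m. i \<le> N \<Longrightarrow> m \<le> N \<Longrightarrow> (\<Sum>n\<le>N. c n i m) = 1" and x: "(\<Sum>n\<le>N. x n) = 1"
  shows "(\<Sum>n\<le>N. wild N c x k n) = 1"
proof (induction k rule: less_induct)
  case (less k)
  show ?case
  proof (cases k)
    case 0
    then show ?thesis using x by simp
  next
    case (Suc k')
    have "(\<Sum>n\<le>N. \<Sum>j\<le>k'. \<Sum>i\<le>N. \<Sum>m\<le>N. c n i m * wild N c x j i * wild N c x (k' - j) m)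
        = (\<Sum>j\<le>k'. \<Sum>i\<le>N. \<Sum>m\<le>N. \<Sum>n\<le>N. c n i m * wild N c x j i * wild N c x (k' - j) m)"
      by (subst sum.swap, rule sum.cong[OF refl], subst sum.swap, rule sum.cong[OF refl], rule sum.swap)
    also have "\<dots> = (\<Sum>j\<le>k'. \<Sum>i\<le>N. \<Sum>m\<le>N. wild N c x j i * wild N c x (k' - j) m)"
      by (intro sum.cong refl) (simp add: c sum_distrib_right[symmetric])
    also have "\<dots> = (\<Sum>j\<le>k'. (\<Sum>i\<le>N. wild N c x j i) * (\<Sum>m\<le>N. wild N c x (k' - j) m))"
      by (simp add: sum_product)
    also have "\<dots> = (\<Sum>j\<le>k'. 1)"
      using less Suc by (intro sum.cong) auto
    finally show ?thesis
      by (simp add: Suc sum_divide_distrib[symmetric])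
  qed
qed

text \<open>Comparison with the geometric series, over a general field so that it serves the real
  series and their complex extensions alike.\<close>

lemma bounded_coeffs_summable:
  fixes a :: "nat \<Rightarrow> real" and z :: "'a::{real_normed_field,banach}"
  assumes "\<And>k. \<bar>a k\<bar> \<le> 1" "norm z < 1"
  shows "summable (\<lambda>k. norm (of_real (a k) * z ^ k))"
proof (rule summable_comparison_test')
  show "summable (\<lambda>k. norm z ^ k)" using assms(2) by simp
  show "norm (norm (of_real (a k) * z ^ k)) \<le> norm z ^ k" for k
    using assms(1)[of k] by (simp add: norm_mult norm_power mult_left_le_one_le)
qed

text \<open>Termwise differentiation shifts the coefficients, and the recurrence says that the
  shifted coefficients are those of the Cauchy products on the right.\<close>

lemma wild_has_derivative:
  assumes a: "\<And>n k. n \<le> N \<Longrightarrow> \<bar>a k n\<bar> \<le> 1"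
    and rec: "\<And>k. real (Suc k) * a (Suc k) n =
      (\<Sum>j\<le>k. \<Sum>i\<le>N. \<Sum>m\<le>N. c n i m * a j i * a (k - j) m)"
    and "n \<le> N" "\<bar>r\<bar> < (1::real)"
  shows "((\<lambda>r. \<Sum>k. a k n * r ^ k) has_real_derivative
     (\<Sum>i\<le>N. \<Sum>m\<le>N. c n i m * (\<Sum>k. a k i * r ^ k) * (\<Sum>k. a k m * r ^ k))) (at r)"
proof -
  have summ: "summable (\<lambda>k. norm (a k i * r ^ k))" if "i \<le> N" "\<bar>r\<bar> < 1" for i r
    using bounded_coeffs_summable[of "\<lambda>k. a k i" r] a that by simp
  \<comment> \<open>Termwise differentiation at \<open>r\<close> requires summability at a point of
    larger modulus.\<close>
  obtain K where K: "\<bar>r\<bar> < K" "K < 1" using assms(4) dense by blast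
  have "((\<lambda>r. \<Sum>k. a k n * r ^ k) has_real_derivative (\<Sum>k. diffs (\<lambda>k. a k n) k * r ^ k)) (at r)"
    using K summ[OF \<open>n \<le> N\<close>, of K]
    by (intro termdiffs_strong[of _ K]) (auto intro: summable_norm_cancel)
  moreover have "(\<lambda>k. diffs (\<lambda>k. a k n) k * r ^ k) sums
      (\<Sum>i\<le>N. \<Sum>m\<le>N. c n i m * (\<Sum>k. a k i * r ^ k) * (\<Sum>k. a k m * r ^ k))"
  proof -
    have "(\<lambda>k. \<Sum>i\<le>N. \<Sum>m\<le>N. c n i m * (\<Sum>j\<le>k. (a j i * r ^ j) * (a (k - j) m * r ^ (k - j)))) sums
      (\<Sum>i\<le>N. \<Sum>m\<le>N. c n i m * ((\<Sum>k. a k i * r ^ k) * (\<Sum>k. a k m * r ^ k)))"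
      using summ assms(4) by (intro sums_sum sums_mult Cauchy_product_sums) auto
    moreover have "(\<Sum>i\<le>N. \<Sum>m\<le>N. c n i m * (\<Sum>j\<le>k. (a j i * r ^ j) * (a (k - j) m * r ^ (k - j))))
       = diffs (\<lambda>k. a k n) k * r ^ k" for k
    proof -
      have "diffs (\<lambda>k. a k n) k * r ^ k =
          (\<Sum>j\<le>k. \<Sum>i\<le>N. \<Sum>m\<le>N. c n i m * ((a j i * r ^ j) * (a (k - j) m * r ^ (k - j))))"
        unfolding diffs_def of_nat_Suc[symmetric] rec sum_distrib_right
        by (intro sum.cong refl) (simp add: power_add[symmetric] mult_ac)
      also have "\<dots> = (\<Sum>i\<le>N. \<Sum>m\<le>N. \<Sum>j\<le>k. c n i m * ((a j i * r ^ j) * (a (k - j) m * r ^ (k - j))))"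
        by (subst sum.swap, rule sum.cong[OF refl], rule sum.swap)
      finally show ?thesis by (simp add: sum_distrib_left)
    qed
    ultimately show ?thesis by (simp add: mult.assoc)
  qed
  ultimately show ?thesis by (simp add: sums_iff)
qed

section \<open>The quadratic system in rescaled time\<close>

lemma rate_sum_zero:
  assumes "i \<le> l" "m \<le> l"
  shows "(\<Sum>n\<le>l. rate l n i m) = 0"
proof -
  \<comment> \<open>Two clusters are produced and the loss has weight 2. The bracket sums to 0 even
    where \<open>i + m - l\<close> is truncated, since that index always lies in
    \<open>{..l}\<close>.\<close>
  have "(\<Sum>n\<le>l. of_bool (n = i + m - l) + of_bool (n = 0) - 2 * of_bool (n = i)) = (0 :: real)"
    using assms by (simp add: sum.distrib sum_subtractf sum_distrib_left[symmetric] of_bool_def)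
  then show ?thesis unfolding rate_def by (simp add: sum_distrib_left[symmetric])
qed

text \<open>Only the loss of the first reactant is negative, and it is at most
  \<open>2 * l\<^sup>2\<close>; this fixes the constant \<open>C\<close> that makes the shifted
  rates nonnegative.\<close>

lemma rate_lower_bound:
  assumes "i \<le> l" "m \<le> l"
  shows "- 2 * (real l)\<^sup>2 * of_bool (n = i) \<le> rate l n i m"
proof -
  have "real i * real m \<le> (real l)\<^sup>2"
    unfolding power2_eq_square using assms by (intro mult_mono) auto
  then have "2 * (real i * real m) \<le> 2 * (real l)\<^sup>2" "real i * real m \<le> 2 * (real l)\<^sup>2"
    using zero_le_power2[of "real l"] by linarith+
  then show ?thesis by (auto simp: rate_def)
qed

text \<open>Dividing the rates by \<open>C\<close> and adding the identity gives nonnegative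
  coefficients with column sums 1. The Wild sum \<open>v\<close> then has probability vectors as
  coefficients and total mass \<open>1 / (1 - r)\<close>. Rescaling to mass 1 removes the added
  identity and leaves the drift over \<open>C * (1 - r)\<close>.\<close>

lemma parametrization:
  assumes l: "1 \<le> l" and u0: "\<forall>n\<in>{1..l}. 0 \<le> u0 n" "(\<Sum>n = 1..l. u0 n) = 1" and M0: "M l u0 \<noteq> 0"
  obtains a :: "nat \<Rightarrow> nat \<Rightarrow> real" and w :: "real \<Rightarrow> nat \<Rightarrow> real"
  where "w = (\<lambda>r n. (1 - r) * (\<Sum>k. a k n * r ^ k))"
    and "\<And>k n. n \<le> l \<Longrightarrow> \<bar>a k n\<bar> \<le> 1"
    and "\<And>n. 1 \<le> n \<Longrightarrow> n \<le> l \<Longrightarrow> w 0 n = u0 n" "w 0 0 = 0"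
    and "\<And>r n. 0 \<le> r \<Longrightarrow> r < 1 \<Longrightarrow> n \<le> l \<Longrightarrow> 0 \<le> w r n"
    and "\<And>r. 0 \<le> r \<Longrightarrow> r < 1 \<Longrightarrow> (\<Sum>n\<le>l. w r n) = 1"
    and "\<And>r. 0 \<le> r \<Longrightarrow> r < 1 \<Longrightarrow> 0 < M l (w r)"
    and "\<And>r n. \<bar>r\<bar> < 1 \<Longrightarrow> n \<le> l \<Longrightarrow>
      ((\<lambda>r. w r n) has_real_derivative drift l (w r) n / (2 * (real l)\<^sup>2 * (1 - r))) (at r)"
proof -
  define C where "C = 2 * (real l)\<^sup>2"
  have C: "0 < C" using l by (simp add: C_def)
  define c where "c n i m = rate l n i m / C + of_bool (n = i)" for n i m
  have c_nonneg: "0 \<le> c n i m" if "i \<le> l" "m \<le> l" for n i m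
    using rate_lower_bound[OF that, of n] C by (simp add: c_def C_def field_simps)
  have c_sum: "(\<Sum>n\<le>l. c n i m) = 1" if "i \<le> l" "m \<le> l" for i m
    using that by (simp add: c_def sum.distrib sum_divide_distrib[symmetric] rate_sum_zero of_bool_def)
  have c_quad: "(\<Sum>i\<le>l. \<Sum>m\<le>l. c n i m * x i * x m) = drift l x n / C + x n * (\<Sum>m\<le>l. x m)"
    if "n \<le> l" for n x
  proof -
    have "(\<Sum>i\<le>l. \<Sum>m\<le>l. c n i m * x i * x m) =
        drift l x n / C + (\<Sum>i\<le>l. of_bool (n = i) * (\<Sum>m\<le>l. x i * x m))"
      unfolding c_def drift_def sum_divide_distrib sum_distrib_left sum.distrib[symmetric]
      by (intro sum.cong refl) (simp add: field_simps)
    also have "(\<Sum>i\<le>l. of_bool (n = i) * (\<Sum>m\<le>l. x i * x m)) = (\<Sum>i\<le>l. if n = i then \<Sum>m\<le>l. x i * x m else 0)"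
      by (intro sum.cong) auto
    also have "\<dots> = x n * (\<Sum>m\<le>l. x m)" using that by (simp add: sum_distrib_left)
    finally show ?thesis .
  qed
  \<comment> \<open>No cluster of size 0 is present at the start, whatever the value
    \<open>u0 0\<close>.\<close>
  define x where "x n = (if n = 0 then 0 else u0 n)" for n
  have x: "0 \<le> x n" if "n \<le> l" for n using u0 that by (auto simp: x_def)
  have x_sum: "(\<Sum>n\<le>l. x n) = 1"
  proof -
    have "(\<Sum>n\<le>l. x n) = (\<Sum>n = 1..l. u0 n)"
      by (intro sum.mono_neutral_cong_right) (auto simp: x_def)
    then show ?thesis using u0 by simp
  qed
  define a where "a = wild l c x"
  have a_nonneg: "0 \<le> a k n" if "n \<le> l" for k n
    unfolding a_def using that c_nonneg x by (intro wild_nonneg) auto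
  have a_sum: "(\<Sum>n\<le>l. a k n) = 1" for k
    unfolding a_def using c_sum x_sum by (intro wild_sum) auto
  have a_le: "\<bar>a k n\<bar> \<le> 1" if "n \<le> l" for k n
    using member_le_sum[of n "{..l}" "a k"] a_nonneg that a_sum[of k] by auto
  define v where "v r n = (\<Sum>k. a k n * r ^ k)" for r n
  define w where "w r n = (1 - r) * v r n" for r n
  have summ: "summable (\<lambda>k. a k n * r ^ k)" if "n \<le> l" "\<bar>r\<bar> < 1" for r n
    using bounded_coeffs_summable[of "\<lambda>k. a k n" r] a_le that by (auto intro: summable_norm_cancel)
  have v_0: "v 0 n = x n" for n unfolding v_def by (simp add: a_def)
  \<comment> \<open>All terms of the series are nonnegative, and the one at \<open>k = 0\<close> is
    \<open>x n\<close>.\<close>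
  have v_ge: "x n \<le> v r n" if "n \<le> l" "0 \<le> r" "r < 1" for r n
  proof -
    have "(\<Sum>k\<in>{0}. a k n * r ^ k) \<le> v r n"
      unfolding v_def using that a_nonneg summ by (intro sum_le_suminf) auto
    then show ?thesis by (simp add: a_def)
  qed
  have v_nonneg: "0 \<le> v r n" if "n \<le> l" "0 \<le> r" "r < 1" for r n
    using v_ge[OF that] x[OF that(1)] by linarith
  have v_sum: "(\<Sum>n\<le>l. v r n) = 1 / (1 - r)" if "\<bar>r\<bar> < 1" for r
  proof -
    have "(\<Sum>n\<le>l. v r n) = (\<Sum>k. \<Sum>n\<le>l. a k n * r ^ k)"
      unfolding v_def using that summ by (intro suminf_sum[symmetric]) auto
    also have "\<dots> = (\<Sum>k. r ^ k)" by (simp add: sum_distrib_right[symmetric] a_sum)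
    finally show ?thesis using that by (simp add: suminf_geometric)
  qed
  have drift_w: "drift l (w r) n = (1 - r)\<^sup>2 * drift l (v r) n" for r n
    unfolding w_def drift_scale ..
  have v_deriv: "((\<lambda>r. v r n) has_real_derivative drift l (v r) n / C + v r n / (1 - r)) (at r)"
    if "\<bar>r\<bar> < 1" "n \<le> l" for r n
  proof -
    have "((\<lambda>r. v r n) has_real_derivative (\<Sum>i\<le>l. \<Sum>m\<le>l. c n i m * v r i * v r m)) (at r)"
      unfolding v_def using a_le that by (intro wild_has_derivative) (auto simp: a_def)
    then show ?thesis unfolding c_quad[OF that(2)] v_sum[OF that(1)] by simp
  qed
  have w_deriv: "((\<lambda>r. w r n) has_real_derivative drift l (w r) n / (C * (1 - r))) (at r)"
    if "\<bar>r\<bar> < 1" "n \<le> l" for r n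
  proof -
    \<comment> \<open>Differentiating \<open>1 - r\<close> contributes \<open>- v r n\<close>, which
      cancels \<open>v r n / (1 - r)\<close> times \<open>1 - r\<close>.\<close>
    have "((\<lambda>r. (1 - r) * v r n) has_real_derivative
        (0 - 1) * v r n + (drift l (v r) n / C + v r n / (1 - r)) * (1 - r)) (at r)"
      by (intro derivative_intros v_deriv that)
    moreover have "(0 - 1) * v r n + (drift l (v r) n / C + v r n / (1 - r)) * (1 - r) =
        drift l (w r) n / (C * (1 - r))"
      unfolding drift_w using that C by (simp add: divide_simps) (simp add: power2_eq_square algebra_simps)
    ultimately show ?thesis unfolding w_def by simp
  qed
  show ?thesis
  proof (rule that[of w a])
    show "w = (\<lambda>r n. (1 - r) * (\<Sum>k. a k n * r ^ k))" by (simp add: w_def v_def fun_eq_iff)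
    \<comment> \<open>Positivity propagates: \<open>v\<close> dominates its initial state
      \<open>x\<close>, and \<open>M l (w r)\<close> is \<open>(1 - r)\<^sup>2\<close> times
      \<open>M l (v r)\<close>.\<close>
    show "0 < M l (w r)" if "0 \<le> r" "r < 1" for r
    proof -
      have "0 < M l u0" using M_nonneg[of l u0] u0 M0 by fastforce
      also have "M l u0 = M l x" unfolding M_def by (intro sum.cong) (auto simp: x_def)
      also have "\<dots> \<le> M l (v r)" using v_ge x that by (intro M_mono) auto
      finally show ?thesis using drift_w[of r 0] that by (simp add: drift_0)
    qed
    show "(\<Sum>n\<le>l. w r n) = 1" if "0 \<le> r" "r < 1" for r
      using v_sum[of r] that by (simp add: w_def sum_distrib_left[symmetric])
  qed (use a_le v_0 v_nonneg w_deriv in \<open>auto simp: w_def x_def C_def\<close>)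
qed

subsection \<open>Real analyticity of reparametrized power series\<close>

text \<open>The complex extension makes holomorphic inverses and Taylor expansions
  available.\<close>

lemma real_power_series_complexify:
  fixes a :: "nat \<Rightarrow> real"
  assumes "\<And>k. \<bar>a k\<bar> \<le> 1"
  shows "(\<lambda>z::complex. \<Sum>k. of_real (a k) * z ^ k) holomorphic_on ball 0 1"
    and "\<bar>r\<bar> < 1 \<Longrightarrow> (\<Sum>k. of_real (a k) * of_real r ^ k :: complex) = of_real (\<Sum>k. a k * r ^ k)"
proof -
  have "(\<lambda>z::complex. \<Sum>k. of_real (a k) * z ^ k) field_differentiable at z" if z: "norm z < 1" for z
  proof -
    obtain K where K: "norm z < K" "K < 1" using z dense by blast
    then have "\<bar>K\<bar> < 1" using norm_ge_zero[of z] by linarith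
    then have "summable (\<lambda>k. of_real (a k) * (of_real K :: complex) ^ k)"
      using bounded_coeffs_summable[of a "of_real K :: complex"] assms
      by (auto intro: summable_norm_cancel)
    then show ?thesis unfolding field_differentiable_def using K norm_ge_zero[of z]
      by (intro exI) (rule termdiffs_strong[of _ "of_real K"], auto)
  qed
  then show "(\<lambda>z::complex. \<Sum>k. of_real (a k) * z ^ k) holomorphic_on ball 0 1"
    by (auto simp: holomorphic_on_def intro: field_differentiable_at_within)
  show "(\<Sum>k. of_real (a k) * of_real r ^ k :: complex) = of_real (\<Sum>k. a k * r ^ k)" if "\<bar>r\<bar> < 1"
    using bounded_coeffs_summable[of a r] assms that suminf_of_real[of "\<lambda>k. a k * r ^ k", where 'a=complex]
    by (simp add: summable_norm_cancel)
qed

text \<open>The complex derivative can be computed along the real axis, where \<open>F\<close>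
  agrees with \<open>f\<close>.\<close>

lemma deriv_real_extension:
  fixes F :: "complex \<Rightarrow> complex" and f :: "real \<Rightarrow> real"
  assumes F: "F field_differentiable at (of_real r)" and f: "(f has_real_derivative D) (at r)"
    and "open S" "r \<in> S" and eq: "\<And>x. x \<in> S \<Longrightarrow> F (of_real x) = of_real (f x)"
  shows "deriv F (of_real r) = of_real D"
proof -
  have "((\<lambda>x. complex_of_real (f x)) has_vector_derivative of_real D) (at r)"
    using f by (intro has_vector_derivative_of_real) (simp add: has_real_derivative_iff_has_vector_derivative)
  moreover have "((F \<circ> of_real) has_vector_derivative 1 * deriv F (of_real r)) (at r)"
    using F by (intro field_vector_diff_chain_at)
      (auto simp: field_differentiable_derivI intro!: derivative_eq_intros)
  then have "((\<lambda>x. complex_of_real (f x)) has_vector_derivative deriv F (of_real r)) (at r)"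
    using has_vector_derivative_transform_within_open[OF _ \<open>open S\<close> \<open>r \<in> S\<close>, of "F \<circ> of_real"] eq by simp
  ultimately show ?thesis using vector_derivative_unique_at by blast
qed

text \<open>Near each point of \<open>S\<close>, \<open>u\<close> is the restriction of
  \<open>W \<circ> G\<close>, with \<open>G\<close> a holomorphic local inverse of \<open>F\<close>.
  As \<open>G\<close> lives on a full complex neighbourhood, end points of \<open>S\<close> are
  covered as well.\<close>

lemma real_analytic_on_reparametrization:
  fixes F W :: "complex \<Rightarrow> complex" and f g u :: "real \<Rightarrow> real"
  assumes F: "F holomorphic_on A" and W: "W holomorphic_on A" and "open A"
    and g: "continuous_on S g" "\<And>t. t \<in> S \<Longrightarrow> of_real (g t) \<in> A"
    and Ff: "\<And>x. of_real x \<in> A \<Longrightarrow> F (of_real x) = of_real (f x)"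
    and f: "\<And>t. t \<in> S \<Longrightarrow> f (g t) = t"
      "\<And>t. t \<in> S \<Longrightarrow> \<exists>D. D \<noteq> 0 \<and> (f has_real_derivative D) (at (g t))"
    and Wu: "\<And>t. t \<in> S \<Longrightarrow> W (of_real (g t)) = of_real (u t)"
  shows "real_analytic_on u S"
  unfolding real_analytic_on_def
proof
  fix x assume x: "x \<in> S"
  define p where "p = complex_of_real (g x)"
  have p: "p \<in> A" using g x by (simp add: p_def)
  obtain D where D: "D \<noteq> 0" "(f has_real_derivative D) (at (g x))" using f x by blast
  have "deriv F p = of_real D"
    unfolding p_def
  proof (rule deriv_real_extension[OF _ D(2)])
    show "F field_differentiable at (of_real (g x))"
      using F p \<open>open A\<close> by (simp add: p_def holomorphic_on_imp_differentiable_at)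
    show "open (complex_of_real -` A)"
      using \<open>open A\<close> by (intro continuous_open_vimage) (auto intro: continuous_intros)
  qed (use p Ff in \<open>auto simp: p_def\<close>)
  then have "deriv F p \<noteq> 0" using D by simp
  then obtain \<rho> where \<rho>: "0 < \<rho>" "ball p \<rho> \<subseteq> A" "open (F ` ball p \<rho>)" "inj_on F (ball p \<rho>)"
    using has_complex_derivative_locally_invertible[OF F p \<open>open A\<close>] by blast
  have hol: "F holomorphic_on ball p \<rho>" "W holomorphic_on ball p \<rho>"
    using F W \<rho> holomorphic_on_subset by blast+
  obtain G where G: "G holomorphic_on F ` ball p \<rho>" "\<And>z. z \<in> ball p \<rho> \<Longrightarrow> G (F z) = z"
    using holomorphic_has_inverse[OF hol(1) open_ball \<rho>(4)] by metis
  have WG: "(W \<circ> G) holomorphic_on F ` ball p \<rho>"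
    using G by (intro holomorphic_on_compose_gen[OF G(1) hol(2)]) auto
  have "F p = of_real x" using Ff p f(1) x by (simp add: p_def)
  then have "of_real x \<in> F ` ball p \<rho>" using \<rho> by (metis centre_in_ball imageI)
  then obtain e where e: "0 < e" "ball (of_real x) e \<subseteq> F ` ball p \<rho>"
    using \<rho>(3) openE by blast
  \<comment> \<open>Continuity of \<open>g\<close> keeps \<open>g t\<close> in the ball where
    \<open>F\<close> is injective, so that \<open>G\<close> picks the same preimage as
    \<open>g\<close>.\<close>
  obtain d where d: "0 < d" "\<And>t. t \<in> S \<Longrightarrow> dist t x < d \<Longrightarrow> dist (g t) (g x) < \<rho>"
    using g(1) x \<rho>(1) unfolding continuous_on_iff by blast
  define c where "c k = (deriv ^^ k) (W \<circ> G) (of_real x) / fact k" for k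
  have "(\<lambda>k. Re (c k) * (t - x) ^ k) sums u t" if t: "t \<in> S" "\<bar>t - x\<bar> < min d e" for t
  proof -
    have "complex_of_real t \<in> ball (of_real x) e"
      using t by (simp add: dist_real_def dist_commute)
    then have "(\<lambda>k. c k * (of_real t - of_real x) ^ k) sums (W \<circ> G) (of_real t)"
      unfolding c_def using WG e by (intro holomorphic_power_series) (auto intro: holomorphic_on_subset)
    moreover have "complex_of_real (g t) \<in> ball p \<rho>"
      using d(2)[of t] t by (simp add: p_def dist_real_def dist_commute)
    then have "G (of_real t) = of_real (g t)"
      using G(2) Ff[of "g t"] f(1) g(2) t by (metis)
    ultimately have "(\<lambda>k. c k * of_real ((t - x) ^ k)) sums of_real (u t)"
      using Wu t by simp
    \<comment> \<open>Taking real parts avoids showing that the coefficients are real.\<close>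
    then have "(\<lambda>k. Re (c k * of_real ((t - x) ^ k))) sums Re (of_real (u t))"
      by (rule sums_Re)
    then show ?thesis by simp
  qed
  then show "\<exists>a r. 0 < r \<and> (\<forall>t\<in>S. \<bar>t - x\<bar> < r \<longrightarrow> (\<lambda>k. a k * (t - x) ^ k) sums u t)"
    using d e by (intro exI[of _ "\<lambda>k. Re (c k)"] exI[of _ "min d e"]) auto
qed

subsection \<open>Uniqueness\<close>

text \<open>Boundedness is carried along with the Lipschitz condition because together they are
  closed under products. Only indices \<open>1..l\<close> enter the distance.\<close>

definition lip_bdd :: "nat \<Rightarrow> (nat \<Rightarrow> real) set \<Rightarrow> ((nat \<Rightarrow> real) \<Rightarrow> real) \<Rightarrow> bool" where
  "lip_bdd l X f \<longleftrightarrow> (\<exists>K. (\<forall>x\<in>X. \<bar>f x\<bar> \<le> K) \<and>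
     (\<forall>x\<in>X. \<forall>y\<in>X. \<bar>f x - f y\<bar> \<le> K * (\<Sum>n = 1..l. \<bar>x n - y n\<bar>)))"

lemma lip_bddI:
  assumes "\<And>x. x \<in> X \<Longrightarrow> \<bar>f x\<bar> \<le> K"
    and "\<And>x y. x \<in> X \<Longrightarrow> y \<in> X \<Longrightarrow> \<bar>f x - f y\<bar> \<le> L * (\<Sum>n = 1..l. \<bar>x n - y n\<bar>)"
  shows "lip_bdd l X f"
  unfolding lip_bdd_def
proof (intro exI[of _ "max K L"] conjI ballI)
  fix x y assume "x \<in> X" "y \<in> X"
  then show "\<bar>f x - f y\<bar> \<le> max K L * (\<Sum>n = 1..l. \<bar>x n - y n\<bar>)"
    by (rule order_trans[OF assms(2) mult_right_mono]) (auto intro: sum_nonneg)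
qed (use assms(1) in fastforce)

lemma lip_bddE:
  assumes "lip_bdd l X f"
  obtains K where "0 \<le> K" "\<And>x. x \<in> X \<Longrightarrow> \<bar>f x\<bar> \<le> K"
    "\<And>x y. x \<in> X \<Longrightarrow> y \<in> X \<Longrightarrow> \<bar>f x - f y\<bar> \<le> K * (\<Sum>n = 1..l. \<bar>x n - y n\<bar>)"
proof -
  obtain K where K: "\<forall>x\<in>X. \<bar>f x\<bar> \<le> K"
    "\<forall>x\<in>X. \<forall>y\<in>X. \<bar>f x - f y\<bar> \<le> K * (\<Sum>n = 1..l. \<bar>x n - y n\<bar>)"
    using assms unfolding lip_bdd_def by blast
  show ?thesis
  \<comment> \<open>\<open>K\<close> can be negative if \<open>X\<close> is empty, hence the
    maximum.\<close>
  proof (rule that[of "max K 0"])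
    show "\<bar>f x - f y\<bar> \<le> max K 0 * (\<Sum>n = 1..l. \<bar>x n - y n\<bar>)" if "x \<in> X" "y \<in> X" for x y
      by (rule order_trans[OF K(2)[rule_format, OF that] mult_right_mono]) (auto intro: sum_nonneg)
  qed (use K(1) in fastforce)+
qed

lemma lip_bdd_const: "lip_bdd l X (\<lambda>_. c)"
  by (rule lip_bddI[of _ _ "\<bar>c\<bar>" 0]) auto

lemma lip_bdd_component:
  assumes "\<And>x. x \<in> X \<Longrightarrow> x n \<in> {0..1}" "n \<in> {1..l}"
  shows "lip_bdd l X (\<lambda>x. x n)"
proof (rule lip_bddI[of _ _ 1 1])
  show "\<bar>x n - y n\<bar> \<le> 1 * (\<Sum>n = 1..l. \<bar>x n - y n\<bar>)" for x y :: "nat \<Rightarrow> real"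
    using member_le_sum[of n "{1..l}" "\<lambda>n. \<bar>x n - y n\<bar>"] assms(2) by simp
qed (use assms(1) in auto)

lemma lip_bdd_add:
  assumes "lip_bdd l X f" "lip_bdd l X g"
  shows "lip_bdd l X (\<lambda>x. f x + g x)"
proof -
  obtain K where K: "0 \<le> K" "\<And>x. x \<in> X \<Longrightarrow> \<bar>f x\<bar> \<le> K"
    "\<And>x y. x \<in> X \<Longrightarrow> y \<in> X \<Longrightarrow> \<bar>f x - f y\<bar> \<le> K * (\<Sum>n = 1..l. \<bar>x n - y n\<bar>)"
    by (rule lip_bddE[OF assms(1)], rule that)
  obtain L where L: "0 \<le> L" "\<And>x. x \<in> X \<Longrightarrow> \<bar>g x\<bar> \<le> L"
    "\<And>x y. x \<in> X \<Longrightarrow> y \<in> X \<Longrightarrow> \<bar>g x - g y\<bar> \<le> L * (\<Sum>n = 1..l. \<bar>x n - y n\<bar>)"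
    by (rule lip_bddE[OF assms(2)], rule that)
  show ?thesis
  proof (rule lip_bddI[of _ _ "K + L" "K + L"])
    show "\<bar>f x + g x\<bar> \<le> K + L" if "x \<in> X" for x
      using add_mono[OF K(2) L(2)] that by (intro order_trans[OF abs_triangle_ineq]) auto
    show "\<bar>f x + g x - (f y + g y)\<bar> \<le> (K + L) * (\<Sum>n = 1..l. \<bar>x n - y n\<bar>)" if "x \<in> X" "y \<in> X" for x y
      using K(3)[OF that] L(3)[OF that] by (simp add: distrib_right)
  qed
qed

lemma lip_bdd_mult:
  assumes "lip_bdd l X f" "lip_bdd l X g"
  shows "lip_bdd l X (\<lambda>x. f x * g x)"
proof -
  obtain K where K: "0 \<le> K" "\<And>x. x \<in> X \<Longrightarrow> \<bar>f x\<bar> \<le> K"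
    "\<And>x y. x \<in> X \<Longrightarrow> y \<in> X \<Longrightarrow> \<bar>f x - f y\<bar> \<le> K * (\<Sum>n = 1..l. \<bar>x n - y n\<bar>)"
    by (rule lip_bddE[OF assms(1)], rule that)
  obtain L where L: "0 \<le> L" "\<And>x. x \<in> X \<Longrightarrow> \<bar>g x\<bar> \<le> L"
    "\<And>x y. x \<in> X \<Longrightarrow> y \<in> X \<Longrightarrow> \<bar>g x - g y\<bar> \<le> L * (\<Sum>n = 1..l. \<bar>x n - y n\<bar>)"
    by (rule lip_bddE[OF assms(2)], rule that)
  show ?thesis
  proof (rule lip_bddI[of _ _ "K * L" "2 * K * L"])
    show "\<bar>f x * g x\<bar> \<le> K * L" if "x \<in> X" for x
      unfolding abs_mult using K L that by (intro mult_mono) auto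
    show "\<bar>f x * g x - f y * g y\<bar> \<le> 2 * K * L * (\<Sum>n = 1..l. \<bar>x n - y n\<bar>)"
      (is "_ \<le> _ * ?E") if "x \<in> X" "y \<in> X" for x y
    proof -
      have "\<bar>f x * g x - f y * g y\<bar> = \<bar>f x * (g x - g y) + (f x - f y) * g y\<bar>"
        by (simp add: algebra_simps)
      also have "\<dots> \<le> \<bar>f x\<bar> * \<bar>g x - g y\<bar> + \<bar>f x - f y\<bar> * \<bar>g y\<bar>"
        by (metis abs_mult abs_triangle_ineq)
      also have "\<dots> \<le> K * (L * ?E) + (K * ?E) * L"
        using K L that by (intro add_mono mult_mono) (auto intro!: sum_nonneg)
      finally show ?thesis by (simp add: algebra_simps)
    qed
  qed
qed

lemma lip_bdd_sum:
  assumes "\<And>i. i \<in> I \<Longrightarrow> lip_bdd l X (f i)"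
  shows "lip_bdd l X (\<lambda>x. \<Sum>i\<in>I. f i x)"
  using assms by (induction I rule: infinite_finite_induct) (auto intro: lip_bdd_add lip_bdd_const)

lemma lip_bdd_inverse:
  assumes "lip_bdd l X f" "0 < \<mu>" "\<And>x. x \<in> X \<Longrightarrow> \<mu> \<le> f x"
  shows "lip_bdd l X (\<lambda>x. inverse (f x))"
proof -
  obtain K where K: "0 \<le> K" "\<And>x. x \<in> X \<Longrightarrow> \<bar>f x\<bar> \<le> K"
    "\<And>x y. x \<in> X \<Longrightarrow> y \<in> X \<Longrightarrow> \<bar>f x - f y\<bar> \<le> K * (\<Sum>n = 1..l. \<bar>x n - y n\<bar>)"
    by (rule lip_bddE[OF assms(1)], rule that)
  have inv: "0 \<le> inverse (f x)" "inverse (f x) \<le> inverse \<mu>" "f x \<noteq> 0" if "x \<in> X" for x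
    using assms(2) assms(3)[OF that] by (auto intro: le_imp_inverse_le)
  show ?thesis
  proof (rule lip_bddI[of _ _ "inverse \<mu>" "inverse \<mu> * inverse \<mu> * K"])
    show "\<bar>inverse (f x) - inverse (f y)\<bar> \<le> inverse \<mu> * inverse \<mu> * K * (\<Sum>n = 1..l. \<bar>x n - y n\<bar>)"
      if "x \<in> X" "y \<in> X" for x y
    proof -
      have "\<bar>inverse (f x) - inverse (f y)\<bar> = inverse (f x) * inverse (f y) * \<bar>f x - f y\<bar>"
      proof -
        have "inverse (f x) - inverse (f y) = - (inverse (f x) * inverse (f y) * (f x - f y))"
          using inv(3)[OF that(1)] inv(3)[OF that(2)] by (simp add: field_simps)
        then show ?thesis using inv(1)[OF that(1)] inv(1)[OF that(2)] by (simp add: abs_mult)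
      qed
      also have "\<dots> \<le> inverse \<mu> * inverse \<mu> * (K * (\<Sum>n = 1..l. \<bar>x n - y n\<bar>))"
        using inv[OF that(1)] inv[OF that(2)] K(1) K(3)[OF that] assms(2) by (intro mult_mono) auto
      finally show ?thesis by (simp add: mult.assoc)
    qed
  qed (use inv in auto)
qed

text \<open>\<open>rhs\<close> is a polynomial in the components and \<open>inverse (M l x)\<close>,
  so the closure properties apply once \<open>M\<close> stays away from 0.\<close>

lemma rhs_lipschitz:
  assumes "0 < \<mu>" "n \<in> {1..l}"
    and X: "\<And>x i. x \<in> X \<Longrightarrow> i \<in> {1..l} \<Longrightarrow> x i \<in> {0..1}" "\<And>x. x \<in> X \<Longrightarrow> \<mu> \<le> M l x"
  shows "lip_bdd l X (\<lambda>x. rhs l x n)"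
proof -
  have comp: "lip_bdd l X (\<lambda>x. x i)" if "i \<in> {1..l}" for i
    using X(1) that by (intro lip_bdd_component) auto
  have "lip_bdd l X (M l)"
    unfolding M_def using comp by (intro lip_bdd_sum lip_bdd_mult lip_bdd_const) auto
  then have inv: "lip_bdd l X (\<lambda>x. inverse (M l x))"
    using assms by (intro lip_bdd_inverse)
  show ?thesis
    unfolding rhs_def divide_inverse diff_conv_add_uminus minus_mult_left using assms(2)
    by (intro lip_bdd_add lip_bdd_sum lip_bdd_mult lip_bdd_const inv comp) auto
qed

text \<open>Integrating factor: \<open>D t * exp (- c * t)\<close> has nonpositive
  derivative.\<close>

lemma gronwall_nonpos:
  fixes D :: "real \<Rightarrow> real"
  assumes D: "\<And>t. t \<in> {0..T} \<Longrightarrow> (D has_real_derivative D' t) (at t within {0..T})"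
    and le: "\<And>t. t \<in> {0..T} \<Longrightarrow> D' t \<le> c * D t" and "D 0 \<le> 0" "t \<in> {0..T}"
  shows "D t \<le> 0"
proof -
  define E where "E t = D t * exp (- c * t)" for t
  have E: "(E has_real_derivative (D' t - c * D t) * exp (- c * t)) (at t within {0..T})" if "t \<in> {0..T}" for t
    unfolding E_def by (auto intro!: derivative_eq_intros D that simp: algebra_simps)
  have "E t \<le> E 0"
  proof (rule DERIV_nonpos_imp_decreasing_open[of 0 t])
    show "\<exists>y. (E has_real_derivative y) (at s) \<and> y \<le> 0" if "0 < s" "s < t" for s
      using E[of s] le[of s] that \<open>t \<in> {0..T}\<close>
      by (intro exI[of _ "(D' s - c * D s) * exp (- c * s)"])
        (auto simp: at_within_Icc_at mult_le_0_iff)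
    show "continuous_on {0..t} E"
      using \<open>t \<in> {0..T}\<close> by (intro continuous_on_subset[OF DERIV_continuous_on[OF E]]) auto
  qed (use assms(4) in auto)
  also have "\<dots> \<le> 0" using assms(3) by (simp add: E_def)
  finally show ?thesis by (simp add: E_def mult_le_0_iff)
qed

section \<open>Uniqueness on closed intervals\<close>

lemma M_continuous_on:
  assumes "\<And>n. n \<in> {1..l} \<Longrightarrow> continuous_on S (\<lambda>t. u t n)"
  shows "continuous_on S (\<lambda>t. M l (u t))"
  unfolding M_def using assms by (intro continuous_intros) auto

text \<open>Along a solution \<open>M\<close> is continuous, nonnegative and nonzero, so its minimum
  over the compact interval is positive.\<close>

lemma solution_M_bounded_below:
  assumes "small_cluster_solution_closed l u0 u T" "0 \<le> T"
  obtains \<mu> where "0 < \<mu>" "\<And>t. t \<in> {0..T} \<Longrightarrow> \<mu> \<le> M l (u t)"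
proof -
  have "continuous_on {0..T} (\<lambda>t. M l (u t))"
    using assms(1) unfolding small_cluster_solution_closed_def
    by (intro M_continuous_on DERIV_continuous_on) blast
  then obtain s where s: "s \<in> {0..T}" "\<forall>t\<in>{0..T}. M l (u s) \<le> M l (u t)"
    using continuous_attains_inf[of "{0..T}" "\<lambda>t. M l (u t)"] assms(2) by fastforce
  moreover have "0 \<le> M l (u s)" "M l (u s) \<noteq> 0"
    using s assms(1) by (auto simp: small_cluster_solution_closed_def intro!: M_nonneg)
  ultimately show ?thesis using that[of "M l (u s)"] by auto
qed

text \<open>Both solutions stay in a set on which \<open>rhs\<close> is Lipschitz. Gronwall's
  inequality is applied to the squared distance, which, unlike a sum of absolute values, is
  differentiable.\<close>

lemma solution_unique:
  assumes u: "small_cluster_solution_closed l u0 u T" and v: "small_cluster_solution_closed l u0 v T"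
    and t: "t \<in> {0..T}" and n: "n \<in> {1..l}"
  shows "u t n = v t n"
proof -
  have T: "0 \<le> T" using t by auto
  obtain \<mu> where \<mu>: "0 < \<mu>" "\<And>t. t \<in> {0..T} \<Longrightarrow> \<mu> \<le> M l (u t)"
    using solution_M_bounded_below[OF u T] by blast
  obtain \<nu> where \<nu>: "0 < \<nu>" "\<And>t. t \<in> {0..T} \<Longrightarrow> \<nu> \<le> M l (v t)"
    using solution_M_bounded_below[OF v T] by blast
  define X where "X = {x. (\<forall>i\<in>{1..l}. x i \<in> {0..1}) \<and> min \<mu> \<nu> \<le> M l x}"
  have inX: "u t \<in> X" "v t \<in> X" if "t \<in> {0..T}" for t
    using u v that \<mu>(2)[OF that] \<nu>(2)[OF that]
    unfolding X_def small_cluster_solution_closed_def by auto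
  have "\<exists>K. 0 \<le> K \<and> (\<forall>x\<in>X. \<forall>y\<in>X. \<bar>rhs l x n - rhs l y n\<bar> \<le> K * (\<Sum>n = 1..l. \<bar>x n - y n\<bar>))"
    if "n \<in> {1..l}" for n
  proof -
    have "lip_bdd l X (\<lambda>x. rhs l x n)"
      using \<mu>(1) \<nu>(1) that by (intro rhs_lipschitz[of "min \<mu> \<nu>"]) (auto simp: X_def)
    then show ?thesis by (rule lip_bddE) blast
  qed
  then obtain K where K: "\<And>n. n \<in> {1..l} \<Longrightarrow> 0 \<le> K n"
    "\<And>n x y. n \<in> {1..l} \<Longrightarrow> x \<in> X \<Longrightarrow> y \<in> X \<Longrightarrow> \<bar>rhs l x n - rhs l y n\<bar> \<le> K n * (\<Sum>n = 1..l. \<bar>x n - y n\<bar>)"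
    using bchoice[of "{1..l}" "\<lambda>n K. 0 \<le> K \<and> (\<forall>x\<in>X. \<forall>y\<in>X. \<bar>rhs l x n - rhs l y n\<bar> \<le> K * (\<Sum>n = 1..l. \<bar>x n - y n\<bar>))"]
    by blast
  define L where "L = (\<Sum>n = 1..l. K n)"
  have L: "0 \<le> L" unfolding L_def by (intro sum_nonneg K)
  have KL: "K n \<le> L" if "n \<in> {1..l}" for n
    unfolding L_def using that K(1) by (intro member_le_sum) auto
  define D where "D t = (\<Sum>n = 1..l. (u t n - v t n)\<^sup>2)" for t
  define D' where "D' t = (\<Sum>n = 1..l. 2 * (u t n - v t n) * (rhs l (u t) n - rhs l (v t) n))" for t
  have "D t \<le> 0"
  \<comment> \<open>\<open>L\<close> is a common Lipschitz constant. The factor \<open>2 * l\<close>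
    is what the double sum of \<open>(d n)\<^sup>2 + (d m)\<^sup>2\<close>, which bounds that of
    \<open>2 * d n * d m\<close>, contributes.\<close>
  proof (rule gronwall_nonpos[where D = D and t = t and D' = D' and T = T and c = "2 * L * l"])
    show "(D has_real_derivative D' t) (at t within {0..T})" if "t \<in> {0..T}" for t
    proof -
      have "((\<lambda>t. (u t n - v t n)\<^sup>2) has_real_derivative
          2 * (u t n - v t n) * (rhs l (u t) n - rhs l (v t) n)) (at t within {0..T})" if "n \<in> {1..l}" for n
      proof -
        have "((\<lambda>t. u t n) has_real_derivative rhs l (u t) n) (at t within {0..T})"
          "((\<lambda>t. v t n) has_real_derivative rhs l (v t) n) (at t within {0..T})"
          using u v that \<open>t \<in> {0..T}\<close> unfolding small_cluster_solution_closed_def by blast+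
        then show ?thesis by (auto intro!: derivative_eq_intros)
      qed
      then show ?thesis unfolding D_def D'_def by (intro DERIV_sum) auto
    qed
    show "D' t \<le> 2 * L * l * D t" if "t \<in> {0..T}" for t
    proof -
      define d where "d n = \<bar>u t n - v t n\<bar>" for n
      have "D' t \<le> (\<Sum>n = 1..l. 2 * (d n * (L * (\<Sum>m = 1..l. d m))))"
        unfolding D'_def
      proof (rule sum_mono)
        fix n assume n: "n \<in> {1..l}"
        have "\<bar>rhs l (u t) n - rhs l (v t) n\<bar> \<le> L * (\<Sum>m = 1..l. d m)"
          unfolding d_def
          by (rule order_trans[OF K(2)[OF n inX[OF that]] mult_right_mono[OF KL[OF n]]]) (simp add: sum_nonneg)
        then have "\<bar>u t n - v t n\<bar> * \<bar>rhs l (u t) n - rhs l (v t) n\<bar> \<le> d n * (L * (\<Sum>m = 1..l. d m))"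
          unfolding d_def by (intro mult_left_mono) auto
        then show "2 * (u t n - v t n) * (rhs l (u t) n - rhs l (v t) n) \<le> 2 * (d n * (L * (\<Sum>m = 1..l. d m)))"
          unfolding abs_mult[symmetric] by linarith
      qed
      also have "\<dots> = L * (\<Sum>n = 1..l. \<Sum>m = 1..l. 2 * d n * d m)"
        by (simp add: sum_distrib_left mult_ac)
      also have "\<dots> \<le> L * (\<Sum>n = 1..l. \<Sum>m = 1..l. (d n)\<^sup>2 + (d m)\<^sup>2)"
        using L by (intro mult_left_mono sum_mono sum_squares_bound)
      also have "\<dots> = 2 * L * l * D t"
        by (simp add: sum.distrib sum_distrib_left[symmetric] D_def d_def)
      finally show ?thesis .
    qed
    show "D 0 \<le> 0"
      using u v by (simp add: D_def small_cluster_solution_closed_def)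
  qed (rule t)
  moreover have "(u t n - v t n)\<^sup>2 \<le> D t"
    unfolding D_def using n by (intro member_le_sum) auto
  ultimately have "(u t n - v t n)\<^sup>2 \<le> 0" by linarith
  then show ?thesis by simp
qed

subsection \<open>Return to the original time\<close>

text \<open>\<open>f r + c * ln (1 - r)\<close> is nondecreasing, so \<open>f\<close> grows at least
  like \<open>- c * ln (1 - r)\<close>.\<close>

lemma DERIV_ge_reciprocal_unbounded:
  fixes f :: "real \<Rightarrow> real"
  assumes "0 < c" "s < 1"
    and f: "\<And>r. s \<le> r \<Longrightarrow> r < 1 \<Longrightarrow> (f has_real_derivative f' r) (at r)"
    and ge: "\<And>r. s \<le> r \<Longrightarrow> r < 1 \<Longrightarrow> c / (1 - r) \<le> f' r"
  shows "\<exists>r. s \<le> r \<and> r < 1 \<and> B < f r"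
proof -
  \<comment> \<open>\<open>r\<close> is chosen so that \<open>ln (1 - r) = ln (1 - s) - h\<close>;
    then \<open>f\<close> gains at least \<open>c * h\<close>, which exceeds
    \<open>B - f s\<close>.\<close>
  define h where "h = (\<bar>B\<bar> + \<bar>f s\<bar> + 1) / c"
  define r where "r = 1 - (1 - s) * exp (- h)"
  have "0 < h" using assms(1) by (simp add: h_def add_nonneg_pos)
  then have "(1 - s) * exp (- h) \<le> 1 - s" using assms(2) by (intro mult_left_le) auto
  then have r: "s \<le> r" "r < 1" using assms(2) unfolding r_def by (linarith, simp)
  have "f s + c * ln (1 - s) \<le> f r + c * ln (1 - r)"
  proof (rule DERIV_nonneg_imp_nondecreasing[of s r])
    fix x assume x: "s \<le> x" "x \<le> r"
    then have "((\<lambda>r. f r + c * ln (1 - r)) has_real_derivative f' x - c / (1 - x)) (at x)"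
      using f[of x] r by (auto intro!: derivative_eq_intros)
    then show "\<exists>y. ((\<lambda>r. f r + c * ln (1 - r)) has_real_derivative y) (at x) \<and> 0 \<le> y"
      using ge[of x] x r by (intro exI[of _ "f' x - c / (1 - x)"]) auto
  qed (rule r)
  also have "ln (1 - r) = ln (1 - s) - h"
    using assms(2) by (simp add: r_def ln_mult)
  finally have "f s + c * h \<le> f r" by (simp add: algebra_simps)
  moreover have "c * h = \<bar>B\<bar> + \<bar>f s\<bar> + 1" using assms(1) by (simp add: h_def)
  ultimately show ?thesis using r by (intro exI[of _ r]) linarith
qed

text \<open>If \<open>M\<close> were at least \<open>e\<close> late enough, it would stay at least
  \<open>e / 2\<close> from there on. Then \<open>w r 0\<close> would have derivative at least a
  positive constant over \<open>1 - r\<close> and would exceed 1.\<close>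

lemma parametrized_M_tends_to_zero:
  fixes w :: "real \<Rightarrow> nat \<Rightarrow> real"
  assumes C: "0 < C"
    and nonneg: "\<And>r n. 0 \<le> r \<Longrightarrow> r < 1 \<Longrightarrow> n \<le> l \<Longrightarrow> 0 \<le> w r n"
    and le1: "\<And>r n. 0 \<le> r \<Longrightarrow> r < 1 \<Longrightarrow> n \<le> l \<Longrightarrow> w r n \<le> 1"
    and deriv: "\<And>r n. 0 \<le> r \<Longrightarrow> r < 1 \<Longrightarrow> n \<le> l \<Longrightarrow>
      ((\<lambda>r. w r n) has_real_derivative drift l (w r) n / (C * (1 - r))) (at r)"
    and e: "0 < e"
  shows "\<exists>R. 0 \<le> R \<and> R < 1 \<and> (\<forall>r. R \<le> r \<longrightarrow> r < 1 \<longrightarrow> M l (w r) < e)"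
proof -
  define f' where "f' r = M l (w r) / (C * (1 - r))" for r
  \<comment> \<open>A summand of \<open>M\<close> with indices \<open>i, j\<close> drops at rate at
    most \<open>4 * i * j * f' r\<close>, since each of its two factors in \<open>[0,1]\<close>
    drops at rate at most \<open>2 * f' r\<close>. The extra 1 makes \<open>K\<close>
    positive.\<close>
  define K where "K = 1 + (\<Sum>i = 1..l. \<Sum>j = 1 + l - i..l. 4 * real i * real j)"
  have K: "0 < K" unfolding K_def by (intro add_pos_nonneg sum_nonneg) auto
  have M_w: "0 \<le> M l (w r)" if "0 \<le> r" "r < 1" for r
    using that nonneg by (intro M_nonneg) auto
  have f'_nonneg: "0 \<le> f' r" if "0 \<le> r" "r < 1" for r
    using M_w[OF that] that C by (simp add: f'_def)
  have f: "((\<lambda>r. w r 0) has_real_derivative f' r) (at r)" if "0 \<le> r" "r < 1" for r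
    using deriv[OF that, of 0] by (simp add: f'_def drift_0)
  have w'_ge: "- 2 * f' r \<le> drift l (w r) n / (C * (1 - r))" if "0 \<le> r" "r < 1" "1 \<le> n" "n \<le> l" for r n
  proof -
    have "- 2 * M l (w r) / (C * (1 - r)) \<le> drift l (w r) n / (C * (1 - r))"
      using drift_ge[of n l "w r"] that nonneg C by (intro divide_right_mono) auto
    then show ?thesis by (simp add: f'_def)
  qed
  \<comment> \<open>In the original time \<open>w\<^sub>0\<close> the components decrease at speed at most 2, so \<open>M\<close> cannot drop
    quickly once it exceeds \<open>e\<close> close to the end.\<close>
  have f_mono: "w r 0 \<le> w s 0" if "0 \<le> r" "r \<le> s" "s < 1" for r s
  proof (rule DERIV_nonneg_imp_nondecreasing[OF that(2)])
    fix x assume "r \<le> x" "x \<le> s"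
    then have "0 \<le> x" "x < 1" using that by auto
    then show "\<exists>y. ((\<lambda>r. w r 0) has_real_derivative y) (at x) \<and> 0 \<le> y"
      using f f'_nonneg by blast
  qed
  have mono: "M l (w r) + K * w r 0 \<le> M l (w s) + K * w s 0" if rs: "0 \<le> r" "r \<le> s" "s < 1" for r s
  proof (rule DERIV_nonneg_imp_nondecreasing[OF rs(2)])
    fix x assume "r \<le> x" "x \<le> s"
    then have x: "0 \<le> x" "x < 1" using rs by auto
    define d where "d n = drift l (w x) n / (C * (1 - x))" for n
    have "((\<lambda>r. M l (w r) + K * w r 0) has_real_derivative
        (\<Sum>i = 1..l. \<Sum>j = 1 + l - i..l. real i * real j * (d i * w x j + w x i * d j)) + K * f' x) (at x)"
      unfolding M_def d_def
      by (intro DERIV_add DERIV_sum)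
        (auto intro!: derivative_eq_intros deriv f x simp: algebra_simps)
    moreover have "(\<Sum>i = 1..l. \<Sum>j = 1 + l - i..l. real i * real j * (d i * w x j + w x i * d j))
        \<ge> (\<Sum>i = 1..l. \<Sum>j = 1 + l - i..l. real i * real j * (- 4 * f' x))"
    proof (intro sum_mono mult_left_mono)
      fix i j assume ij: "i \<in> {1..l}" "j \<in> {1 + l - i..l}"
      have ge: "- 2 * f' x \<le> d n * y" if "1 \<le> n" "n \<le> l" "0 \<le> y" "y \<le> 1" for n y
      proof -
        have "- 2 * f' x \<le> - 2 * f' x * y"
          using mult_left_le[OF that(4) f'_nonneg[OF x]] by simp
        also have "\<dots> \<le> d n * y"
          using w'_ge[OF x that(1,2)] that(3) unfolding d_def by (rule mult_right_mono)
        finally show ?thesis .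
      qed
      have "- 2 * f' x \<le> d i * w x j"
        by (rule ge) (use ij nonneg[OF x] le1[OF x] in auto)
      moreover have "- 2 * f' x \<le> d j * w x i"
        by (rule ge) (use ij nonneg[OF x] le1[OF x] in auto)
      ultimately show "- 4 * f' x \<le> d i * w x j + w x i * d j" by (simp add: mult.commute)
    qed auto
    moreover have "(\<Sum>i = 1..l. \<Sum>j = 1 + l - i..l. real i * real j * (- 4 * f' x)) = - (K - 1) * f' x"
      unfolding K_def by (simp add: sum_distrib_left sum_negf mult_ac)
    ultimately show "\<exists>y. ((\<lambda>r. M l (w r) + K * w r 0) has_real_derivative y) (at x) \<and> 0 \<le> y"
      using f'_nonneg[OF x] by (intro exI conjI) (assumption, simp add: algebra_simps)
  qed
  have bdd: "bdd_above ((\<lambda>r. w r 0) ` {0..<1})"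
    using le1 by (auto intro!: bdd_aboveI[of _ 1])
  \<comment> \<open>\<open>w r 0\<close> increases to its supremum \<open>t\<close>; past
    \<open>R\<close> it grows by less than \<open>e / (2 * K)\<close>, so \<open>M\<close> can lose
    at most \<open>e / 2\<close>.\<close>
  define t where "t = Sup ((\<lambda>r. w r 0) ` {0..<1})"
  have le_t: "w r 0 \<le> t" if "0 \<le> r" "r < 1" for r
    unfolding t_def using that bdd by (intro cSup_upper) auto
  have "t - e / (2 * K) < t" using e K by simp
  then obtain R where R: "0 \<le> R" "R < 1" "t - e / (2 * K) < w R 0"
    unfolding t_def using less_cSup_iff[OF _ bdd] by auto
  have "M l (w r) < e" if r: "R \<le> r" "r < 1" for r
  proof (rule ccontr)
    assume "\<not> M l (w r) < e"
    have "e / 2 / C / (1 - s) \<le> f' s" if s: "r \<le> s" "s < 1" for s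
    proof -
      have "w s 0 - w r 0 \<le> e / (2 * K)" using R r s f_mono[of R r] le_t[of s] by linarith
      then have "K * (w s 0 - w r 0) \<le> e / 2" using K by (simp add: field_simps)
      then have "e / 2 \<le> M l (w s)"
        using mono[of r s] R r s \<open>\<not> M l (w r) < e\<close> by (simp add: algebra_simps)
      then have "e / 2 / (C * (1 - s)) \<le> f' s"
        unfolding f'_def using C s by (intro divide_right_mono) auto
      then show ?thesis by simp
    qed
    moreover have "((\<lambda>r. w r 0) has_real_derivative f' s) (at s)" if "r \<le> s" "s < 1" for s
      using f that R r by auto
    ultimately obtain s where "r \<le> s" "s < 1" "1 < w s 0"
      using DERIV_ge_reciprocal_unbounded[of "e / 2 / C" r "\<lambda>r. w r 0" f' 1] e C r by auto
    then show False using le1[of s 0] R r by auto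
  qed
  then show ?thesis using R by blast
qed

text \<open>The image of \<open>[0,1)\<close> is the interval from 0 up to the supremum
  \<open>\<tau>\<close>, which exists by the bound and is not attained because \<open>f\<close> is
  strictly increasing.\<close>

lemma increasing_inverse:
  fixes f :: "real \<Rightarrow> real"
  assumes f: "\<And>r. 0 \<le> r \<Longrightarrow> r < 1 \<Longrightarrow> (f has_real_derivative f' r) (at r)"
    and pos: "\<And>r. 0 \<le> r \<Longrightarrow> r < 1 \<Longrightarrow> 0 < f' r"
    and "f 0 = 0" and bound: "\<And>r. 0 \<le> r \<Longrightarrow> r < 1 \<Longrightarrow> f r \<le> B"
  obtains g \<tau> where "0 < \<tau>"
    "\<And>r. 0 \<le> r \<Longrightarrow> r < 1 \<Longrightarrow> f r \<in> {0..<\<tau>} \<and> g (f r) = r"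
    "\<And>t. t \<in> {0..<\<tau>} \<Longrightarrow> g t \<in> {0..<1} \<and> f (g t) = t"
    "\<And>s t. 0 \<le> s \<Longrightarrow> s < t \<Longrightarrow> t < \<tau> \<Longrightarrow> g s < g t"
    "continuous_on {0..<\<tau>} g"
    "\<And>t. t \<in> {0..<\<tau>} \<Longrightarrow> (g has_real_derivative 1 / f' (g t)) (at t within {0..<\<tau>})"
proof -
  have mono: "f r < f s" if "0 \<le> r" "r < s" "s < 1" for r s
  proof (rule DERIV_pos_imp_increasing[OF that(2)])
    fix x assume "r \<le> x" "x \<le> s"
    then have "0 \<le> x" "x < 1" using that by auto
    then show "\<exists>y. (f has_real_derivative y) (at x) \<and> 0 < y"
      using f pos by blast
  qed
  have cont: "continuous_on {0..s} f" if "s < 1" for s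
    using that by (intro continuous_at_imp_continuous_on ballI DERIV_isCont[OF f]) auto
  have inj: "inj_on f {0..<1}"
    by (rule linorder_inj_onI) (use mono in force)+
  define \<tau> where "\<tau> = Sup (f ` {0..<1})"
  have bdd: "bdd_above (f ` {0..<1})" using bound by (auto intro!: bdd_aboveI)
  have f_in: "f r \<in> {0..<\<tau>}" if "0 \<le> r" "r < 1" for r
  proof -
    have "f r < f ((r + 1) / 2)" using that by (intro mono) auto
    also have "\<dots> \<le> \<tau>" unfolding \<tau>_def using that bdd by (intro cSup_upper) auto
    finally show ?thesis using mono[of 0 r] \<open>f 0 = 0\<close> that by (cases "r = 0") auto
  qed
  have image_closed: "f ` {0..s} = {0..f s}" if "0 \<le> s" "s < 1" for s
  proof (intro equalityI subsetI)
    fix t assume "t \<in> {0..f s}"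
    then show "t \<in> f ` {0..s}" using IVT'[of f 0 t s] cont[of s] that \<open>f 0 = 0\<close> by force
  next
    fix t assume "t \<in> f ` {0..s}"
    then obtain r where r: "0 \<le> r" "r \<le> s" "t = f r" by auto
    then show "t \<in> {0..f s}" using mono[of r s] f_in[of r] that by (cases "r = s") auto
  qed
  have image: "f ` {0..<1} = {0..<\<tau>}"
  proof (intro equalityI subsetI)
    fix t assume t: "t \<in> {0..<\<tau>}"
    then obtain s where "0 \<le> s" "s < 1" "t < f s"
      unfolding \<tau>_def using less_cSup_iff[OF _ bdd] by auto
    then have "t \<in> f ` {0..s}" using image_closed[of s] t by auto
    then show "t \<in> f ` {0..<1}" using \<open>s < 1\<close> by auto
  qed (use f_in in auto)
  define g where "g = the_inv_into {0..<1} f"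
  have gf: "g (f r) = r" if "r \<in> {0..<1}" for r
    unfolding g_def using the_inv_into_f_f[OF inj that] .
  have fg: "g t \<in> {0..<1} \<and> f (g t) = t" if "t \<in> {0..<\<tau>}" for t
    using that gf unfolding image[symmetric] by auto
  have g_mono: "g s < g t" if "0 \<le> s" "s < t" "t < \<tau>" for s t
  proof (rule ccontr)
    assume "\<not> g s < g t"
    then have "f (g t) \<le> f (g s)"
      using mono[of "g t" "g s"] fg[of s] fg[of t] that by (cases "g t = g s") auto
    then show False using fg[of s] fg[of t] that by auto
  qed
  have g_cont: "continuous_on {0..<\<tau>} g"
    unfolding continuous_on_eq_continuous_within
  proof
    fix t assume t: "t \<in> {0..<\<tau>}"
    \<comment> \<open>Continuity is local, so a compact interval \<open>{0..s}\<close> whose image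
      reaches beyond \<open>t\<close> is enough: there the inverse of a continuous injection is
      continuous.\<close>
    define s where "s = (g t + 1) / 2"
    have s: "0 \<le> s" "s < 1" "g t < s" using fg[OF t] by (auto simp: s_def)
    have "t < f s" using mono[of "g t" s] s fg[OF t] by auto
    have "continuous_on (f ` {0..s}) g"
      using cont s gf by (intro continuous_on_inv) auto
    then have "continuous (at t within {0..f s}) g"
      using t \<open>t < f s\<close> by (simp add: image_closed[OF s(1,2)] continuous_on_eq_continuous_within)
    moreover have "at t within {0..f s} = at t within {0..<\<tau>}"
      using \<open>t < f s\<close> f_in[OF s(1,2)] by (intro at_within_nhd[of _ "{..<f s}"]) auto
    ultimately show "continuous (at t within {0..<\<tau>}) g" by simp
  qed
  have "(g has_real_derivative 1 / f' (g t)) (at t within {0..<\<tau>})" if t: "t \<in> {0..<\<tau>}" for t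
  proof -
    define r where "r = g t"
    have r: "0 \<le> r" "r < 1" "f r = t" using fg[OF t] by (auto simp: r_def)
    \<comment> \<open>Working within the image makes the derivative one-sided at time 0.\<close>
    have "(g has_derivative (\<lambda>h. h / f' r)) (at (f r) within f ` {0..<1})"
    proof (rule has_derivative_inverse_within[where f' = "(*) (f' r)"])
      show "(f has_derivative (*) (f' r)) (at r within {0..<1})"
        using has_field_derivative_at_within[OF f[OF r(1,2)]] by (simp add: has_field_derivative_def)
      show "continuous (at (f r) within f ` {0..<1}) g"
        using g_cont t r unfolding image continuous_on_eq_continuous_within by simp
      show "linear (\<lambda>h. h / f' r)" by (simp add: linear_iff add_divide_distrib)
      show "(\<lambda>h. h / f' r) \<circ> (*) (f' r) = id" using pos[OF r(1,2)] by (auto simp: fun_eq_iff)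
    qed (use r gf in auto)
    moreover have "(\<lambda>h. h / f' r) = (*) (1 / f' r)" by (simp add: fun_eq_iff)
    ultimately show ?thesis
      unfolding has_field_derivative_def image r(3) r_def[symmetric] by simp
  qed
  moreover have "0 < \<tau>" using f_in[of 0] by auto
  ultimately show ?thesis using that[of \<tau> g] f_in gf fg g_mono g_cont by simp
qed

text \<open>\<open>w r 0\<close> is the original time as a function of \<open>r\<close>; composing
  \<open>w\<close> with its inverse \<open>g\<close> undoes the time change.\<close>

lemma solution_exists:
  assumes "1 \<le> l" "\<forall>n\<in>{1..l}. 0 \<le> u0 n" "(\<Sum>n = 1..l. u0 n) = 1" "M l u0 \<noteq> 0"
  obtains u \<tau> where "0 < \<tau>" "small_cluster_solution l u0 u (ereal \<tau>)" "M_left_limit_zero l u \<tau>"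
    "\<forall>n\<in>{1..l}. real_analytic_on (\<lambda>t. u t n) {0..<\<tau>}"
proof -
  obtain a w where w: "w = (\<lambda>r n. (1 - r) * (\<Sum>k. a k n * r ^ k))"
    and a: "\<And>k n. n \<le> l \<Longrightarrow> \<bar>a k n\<bar> \<le> 1"
    and init: "\<And>n. 1 \<le> n \<Longrightarrow> n \<le> l \<Longrightarrow> w 0 n = u0 n" "w 0 0 = 0"
    and nonneg: "\<And>r n. 0 \<le> r \<Longrightarrow> r < 1 \<Longrightarrow> n \<le> l \<Longrightarrow> 0 \<le> w r n"
    and sum: "\<And>r. 0 \<le> r \<Longrightarrow> r < 1 \<Longrightarrow> (\<Sum>n\<le>l. w r n) = 1"
    and M_pos: "\<And>r. 0 \<le> r \<Longrightarrow> r < 1 \<Longrightarrow> 0 < M l (w r)"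
    and deriv: "\<And>r n. \<bar>r\<bar> < 1 \<Longrightarrow> n \<le> l \<Longrightarrow>
      ((\<lambda>r. w r n) has_real_derivative drift l (w r) n / (2 * (real l)\<^sup>2 * (1 - r))) (at r)"
    by (rule parametrization[OF assms], rule that)
  define C where "C = 2 * (real l)\<^sup>2"
  have C: "0 < C" using assms(1) by (simp add: C_def)
  have le1: "w r n \<le> 1" if "0 \<le> r" "r < 1" "n \<le> l" for r n
    using member_le_sum[of n "{..l}" "w r"] nonneg sum that by auto
  define f' where "f' r = M l (w r) / (C * (1 - r))" for r
  have f: "((\<lambda>r. w r 0) has_real_derivative f' r) (at r)" if "0 \<le> r" "r < 1" for r
    using deriv[of r 0] that by (simp add: f'_def drift_0 C_def)
  have f'_pos: "0 < f' r" if "0 \<le> r" "r < 1" for r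
    using that C M_pos by (simp add: f'_def)
  obtain g \<tau> where \<tau>: "0 < \<tau>"
    and gf: "\<And>r. 0 \<le> r \<Longrightarrow> r < 1 \<Longrightarrow> w r 0 \<in> {0..<\<tau>} \<and> g (w r 0) = r"
    and fg: "\<And>t. t \<in> {0..<\<tau>} \<Longrightarrow> g t \<in> {0..<1} \<and> w (g t) 0 = t"
    and g_mono: "\<And>s t. 0 \<le> s \<Longrightarrow> s < t \<Longrightarrow> t < \<tau> \<Longrightarrow> g s < g t"
    and g_cont: "continuous_on {0..<\<tau>} g"
    and g_deriv: "\<And>t. t \<in> {0..<\<tau>} \<Longrightarrow> (g has_real_derivative 1 / f' (g t)) (at t within {0..<\<tau>})"
    by (rule increasing_inverse[of "\<lambda>r. w r 0" f' 1, OF _ _ init(2)],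
        erule (1) f, erule (1) f'_pos, erule (1) le1, simp, rule that)
  define u where "u t = w (g t)" for t
  have u_in: "u t n \<in> {0..1}" if "t \<in> {0..<\<tau>}" "n \<le> l" for t n
    using fg[OF that(1)] nonneg le1 that(2) by (auto simp: u_def)
  have M_u: "M l (u t) \<noteq> 0" if "t \<in> {0..<\<tau>}" for t
    using fg[OF that] M_pos[of "g t"] by (auto simp: u_def)
  have u_deriv: "((\<lambda>t. u t n) has_real_derivative rhs l (u t) n) (at t within {0..<\<tau>})"
    if t: "t \<in> {0..<\<tau>}" and n: "n \<in> {1..l}" for t n
  proof -
    have r: "0 \<le> g t" "g t < 1" using fg[OF t] by auto
    have "((\<lambda>t. w (g t) n) has_real_derivative
        drift l (w (g t)) n / (C * (1 - g t)) * (1 / f' (g t))) (at t within {0..<\<tau>})"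
      unfolding C_def using r n by (intro DERIV_chain2[OF deriv g_deriv[OF t]]) auto
    \<comment> \<open>\<open>f'\<close> is \<open>M\<close> over the same factor
      \<open>C * (1 - r)\<close>, so the factor cancels and drift over \<open>M\<close>
      remains.\<close>
    moreover have "drift l (w (g t)) n / (C * (1 - g t)) * (1 / f' (g t)) = rhs l (w (g t)) n"
      using r n C by (simp add: f'_def rhs_eq)
    ultimately show ?thesis unfolding u_def by simp
  qed
  have u_cont: "continuous_on {0..<\<tau>} (\<lambda>t. u t n)" if "n \<in> {1..l}" for n
    using u_deriv that by (intro DERIV_continuous_on) auto
  have rhs_cont: "continuous_on {0..<\<tau>} (\<lambda>t. rhs l (u t) n)" if "n \<in> {1..l}" for n
    unfolding rhs_def using that M_u
    by (intro continuous_intros u_cont M_continuous_on) auto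
  have g_0: "g 0 = 0" using gf[of 0] init(2) by simp
  have u_init: "\<forall>n\<in>{1..l}. u 0 n = u0 n" using init by (simp add: u_def g_0)
  have "small_cluster_solution_closed l u0 u T" if "0 < T" "T < \<tau>" for T
  proof -
    have sub: "{0..T} \<subseteq> {0..<\<tau>}" using that by auto
    have d: "((\<lambda>t. u t n) has_real_derivative rhs l (u t) n) (at t within {0..T})"
      if "t \<in> {0..T}" "n \<in> {1..l}" for t n
      using has_field_derivative_subset[OF u_deriv sub] that sub by auto
    have "C1_on (\<lambda>t. u t n) {0..T}" if "n \<in> {1..l}" for n
      unfolding C1_on_def using d that continuous_on_subset[OF rhs_cont[OF that] sub]
      by (intro exI[of _ "\<lambda>t. rhs l (u t) n"]) auto
    then show ?thesis
      unfolding small_cluster_solution_closed_def using d u_init M_u u_in sub by auto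
  qed
  then have sol: "small_cluster_solution l u0 u (ereal \<tau>)"
    unfolding small_cluster_solution_def using u_init by auto
  have "((\<lambda>t. M l (u t)) \<longlongrightarrow> 0) (at_left \<tau>)"
  proof (rule tendstoI)
    fix e :: real assume "0 < e"
    then obtain R where R: "0 \<le> R" "R < 1" "\<And>r. R \<le> r \<Longrightarrow> r < 1 \<Longrightarrow> M l (w r) < e"
      using parametrized_M_tends_to_zero[of C l w e] C nonneg le1 deriv unfolding C_def by auto
    \<comment> \<open>By monotonicity of \<open>g\<close>, times after \<open>w R 0\<close>
      correspond to parameters after \<open>R\<close>.\<close>
    have "dist (M l (u t)) 0 < e" if t: "w R 0 < t" "t < \<tau>" for t
    proof -
      have "t \<in> {0..<\<tau>}" using gf[OF R(1,2)] t by auto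
      moreover have "R < g t" using g_mono[of "w R 0" t] gf[OF R(1,2)] t by auto
      ultimately show ?thesis using R(3)[of "g t"] M_pos[of "g t"] fg[of t] by (auto simp: u_def)
    qed
    then show "\<forall>\<^sub>F t in at_left \<tau>. dist (M l (u t)) 0 < e"
      using gf[OF R(1,2)] unfolding eventually_at_left_field by (intro exI[of _ "w R 0"]) auto
  qed
  then have lim: "M_left_limit_zero l u \<tau>" using \<tau> by (simp add: M_left_limit_zero_def)
  have "real_analytic_on (\<lambda>t. u t n) {0..<\<tau>}" if n: "n \<in> {1..l}" for n
  proof -
    define W where "W n z = (1 - z) * (\<Sum>k. of_real (a k n) * z ^ k)" for n and z :: complex
    have hol: "W n holomorphic_on ball 0 1" if "n \<le> l" for n
      unfolding W_def using a that by (intro holomorphic_intros real_power_series_complexify)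
    have real: "W n (of_real r) = of_real (w r n)" if "n \<le> l" "\<bar>r\<bar> < 1" for n r
      unfolding W_def w using real_power_series_complexify(2)[of "\<lambda>k. a k n" r] a that by simp
    show ?thesis
    \<comment> \<open>The function to be inverted is component 0, that is, time; its complex
      extension is \<open>W 0\<close>.\<close>
    proof (rule real_analytic_on_reparametrization[OF hol[of 0] hol[of n] open_ball g_cont])
      show "\<exists>D. D \<noteq> 0 \<and> ((\<lambda>r. w r 0) has_real_derivative D) (at (g t))" if "t \<in> {0..<\<tau>}" for t
        using f[of "g t"] f'_pos[of "g t"] fg[OF that] by (intro exI[of _ "f' (g t)"]) auto
      show "complex_of_real (g t) \<in> ball 0 1" "W n (of_real (g t)) = of_real (u t n)" if "t \<in> {0..<\<tau>}" for t
        using fg[OF that] n real by (auto simp: u_def)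
    qed (use n real fg in auto)
  qed
  then show ?thesis using that[OF \<tau> sol lim] by blast
qed

subsection \<open>Exhaustion times\<close>

lemma M_cong: "(\<And>n. n \<in> {1..l} \<Longrightarrow> x n = y n) \<Longrightarrow> M l x = M l y"
  unfolding M_def by (intro sum.cong refl) auto

text \<open>A time inside the interval is covered by a closed solution reaching beyond it, along
  which \<open>M\<close> is continuous and nonzero. Hence \<open>M\<close> cannot tend to 0 before
  the end of the interval.\<close>

lemma solution_M_left_limit:
  assumes v: "small_cluster_solution l u0 v \<tau>" and s: "0 < s" "ereal s < \<tau>"
  shows "((\<lambda>t. M l (v t)) \<longlongrightarrow> M l (v s)) (at_left s)" "M l (v s) \<noteq> 0"
proof -
  obtain T where T: "ereal s < ereal T" "ereal T < \<tau>" using ereal_dense2[OF s(2)] by blast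
  then have sol: "small_cluster_solution_closed l u0 v T"
    using v s unfolding small_cluster_solution_def by auto
  have "continuous_on {0..T} (\<lambda>t. M l (v t))"
    using sol unfolding small_cluster_solution_closed_def
    by (intro M_continuous_on DERIV_continuous_on) blast
  then have "isCont (\<lambda>t. M l (v t)) s"
    by (rule continuous_on_interior) (use s T in auto)
  then show "((\<lambda>t. M l (v t)) \<longlongrightarrow> M l (v s)) (at_left s)"
    by (simp add: isCont_def filterlim_at_split)
  have "s \<in> {0..T}" using s T by simp
  then show "M l (v s) \<noteq> 0" using sol unfolding small_cluster_solution_closed_def by blast
qed

text \<open>No positive time before \<open>\<tau>\<close> can have left limit 0, and time 0 is
  excluded by \<open>M l u0 \<noteq> 0\<close>. The set under the infimum is therefore empty or
  \<open>{\<tau>}\<close>, with infimum \<open>\<infinity>\<close> or \<open>\<tau>\<close>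
  accordingly.\<close>

lemma exhaustion_time_characterization:
  assumes v: "small_cluster_solution l u0 v \<tau>" and M0: "M l u0 \<noteq> 0"
  shows "\<tau> = exhaustion_time l v \<tau> \<longleftrightarrow>
    \<tau> = \<infinity> \<or> (\<exists>s>0. \<tau> = ereal s \<and> M_left_limit_zero l v s)"
proof -
  define S where "S = {s. 0 \<le> s \<and> ereal s \<le> \<tau> \<and> M_left_limit_zero l v s}"
  have M_v0: "M l (v 0) \<noteq> 0"
    using v M0 M_cong[of l "v 0" u0] by (simp add: small_cluster_solution_def)
  have S: "0 < s \<and> ereal s = \<tau>" if "s \<in> S" for s
  proof -
    have "s \<noteq> 0" using that M_v0 by (auto simp: S_def M_left_limit_zero_def)
    then have "0 < s" using that by (simp add: S_def)
    moreover have False if "ereal s < \<tau>"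
    proof -
      have "((\<lambda>t. M l (v t)) \<longlongrightarrow> 0) (at_left s)"
        using \<open>s \<in> S\<close> \<open>s \<noteq> 0\<close> by (simp add: S_def M_left_limit_zero_def)
      with solution_M_left_limit(1)[OF v \<open>0 < s\<close> that] have "M l (v s) = 0"
        by (rule tendsto_unique[OF trivial_limit_at_left_real])
      then show False using solution_M_left_limit(2)[OF v \<open>0 < s\<close> that] by simp
    qed
    ultimately show ?thesis using that by (auto simp: S_def less_le)
  qed
  show ?thesis
  proof
    assume *: "\<tau> = exhaustion_time l v \<tau>"
    show "\<tau> = \<infinity> \<or> (\<exists>s>0. \<tau> = ereal s \<and> M_left_limit_zero l v s)"
    proof (cases "S = {}")
      case True
      then show ?thesis using * unfolding exhaustion_time_def S_def[symmetric] by (simp add: top_ereal_def)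
    next
      case False
      then obtain s where s: "s \<in> S" by blast
      then have "M_left_limit_zero l v s" by (simp add: S_def)
      then show ?thesis using S[OF s] by blast
    qed
  next
    assume "\<tau> = \<infinity> \<or> (\<exists>s>0. \<tau> = ereal s \<and> M_left_limit_zero l v s)"
    then show "\<tau> = exhaustion_time l v \<tau>"
    proof
      assume "\<tau> = \<infinity>"
      then have "S = {}" using S by auto
      then show ?thesis using \<open>\<tau> = \<infinity>\<close> unfolding exhaustion_time_def S_def[symmetric] by (simp add: top_ereal_def)
    next
      assume "\<exists>s>0. \<tau> = ereal s \<and> M_left_limit_zero l v s"
      then obtain s where s: "0 < s" "\<tau> = ereal s" "M_left_limit_zero l v s" by blast
      then have "s \<in> S" by (simp add: S_def)
      moreover have "x = s" if "x \<in> S" for x using S[OF that] s(2) by simp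
      ultimately have "S = {s}" by blast
      then show ?thesis using s unfolding exhaustion_time_def S_def[symmetric] by simp
    qed
  qed
qed

section \<open>Solutions with different end points\<close>

lemma solution_agree:
  assumes u: "small_cluster_solution l u0 u \<sigma>" and v: "small_cluster_solution l u0 v \<tau>"
    and t: "0 \<le> t" "ereal t < \<sigma>" "ereal t < \<tau>" and n: "n \<in> {1..l}"
  shows "u t n = v t n"
proof -
  obtain T where T: "ereal t < ereal T" "ereal T < min \<sigma> \<tau>"
    using ereal_dense2[of "ereal t" "min \<sigma> \<tau>"] t by auto
  then have "small_cluster_solution_closed l u0 u T" "small_cluster_solution_closed l u0 v T"
    using u v t unfolding small_cluster_solution_def by auto
  then show ?thesis using solution_unique[of l u0 u T v t n] t T n by auto
qed

text \<open>If \<open>v\<close> lived longer, it would agree with \<open>u\<close> before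
  \<open>\<sigma>\<close>, so \<open>M\<close> would tend to 0 along \<open>v\<close> too, at a time
  inside the interval of \<open>v\<close>.\<close>

lemma exhausted_solution_not_extendable:
  assumes u: "small_cluster_solution l u0 u \<sigma>" "\<sigma> = exhaustion_time l u \<sigma>"
    and v: "small_cluster_solution l u0 v \<tau>" and M0: "M l u0 \<noteq> 0"
  shows "\<tau> \<le> \<sigma>"
proof (rule ccontr)
  assume "\<not> \<tau> \<le> \<sigma>"
  then obtain s where s: "0 < s" "\<sigma> = ereal s" "M_left_limit_zero l u s" "ereal s < \<tau>"
    using exhaustion_time_characterization[OF u(1) M0] u(2) by auto
  have "((\<lambda>t. M l (u t)) \<longlongrightarrow> 0) (at_left s)" using s by (simp add: M_left_limit_zero_def)
  moreover have "\<forall>\<^sub>F t in at_left s. M l (u t) = M l (v t)"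
    unfolding eventually_at_left_field
  proof (intro exI[of _ 0] conjI allI impI)
    fix t :: real assume "0 < t" "t < s"
    moreover have "ereal t < \<tau>" using \<open>t < s\<close> s(4) less_trans[of "ereal t" "ereal s" \<tau>] by simp
    ultimately show "M l (u t) = M l (v t)"
      using s by (intro M_cong solution_agree[OF u(1) v]) auto
  qed (rule s)
  ultimately have "((\<lambda>t. M l (v t)) \<longlongrightarrow> 0) (at_left s)"
    by (rule Lim_transform_eventually)
  with solution_M_left_limit(1)[OF v s(1,4)] have "M l (v s) = 0"
    by (rule tendsto_unique[OF trivial_limit_at_left_real])
  then show False using solution_M_left_limit(2)[OF v s(1,4)] by simp
qed

text \<open>For \<open>\<tau> \<ge> 0\<close> time 0 itself is in the set, so the infimum is 0; for
  negative \<open>\<tau>\<close> the set is empty and the infimum infinite.\<close>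

lemma exhaustion_time_degenerate:
  assumes "small_cluster_solution l u0 v \<tau>" "M l u0 = 0"
  shows "\<tau> = exhaustion_time l v \<tau> \<longleftrightarrow> \<tau> = 0"
proof -
  define S where "S = {s. 0 \<le> s \<and> ereal s \<le> \<tau> \<and> M_left_limit_zero l v s}"
  have "M l (v 0) = 0"
    using assms M_cong[of l "v 0" u0] by (simp add: small_cluster_solution_def)
  then have zero: "0 \<in> S \<longleftrightarrow> 0 \<le> \<tau>" by (simp add: S_def M_left_limit_zero_def zero_ereal_def)
  show ?thesis
  proof (cases "0 \<le> \<tau>")
    case True
    have "Inf (ereal ` S) \<le> ereal 0" using zero True by (intro Inf_lower imageI) simp
    moreover have "0 \<le> Inf (ereal ` S)" by (intro Inf_greatest) (auto simp: S_def)
    ultimately have "Inf (ereal ` S) = 0" by (simp add: antisym zero_ereal_def)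
    then show ?thesis unfolding exhaustion_time_def S_def[symmetric] by simp
  next
    case False
    have "S = {}"
    proof (rule equals0I)
      fix s assume "s \<in> S"
      then have "0 \<le> ereal s" "ereal s \<le> \<tau>" by (auto simp: S_def)
      then show False using False order_trans by blast
    qed
    then have "exhaustion_time l v \<tau> = \<infinity>"
      unfolding exhaustion_time_def S_def[symmetric] by (simp add: top_ereal_def)
    then show ?thesis using False by auto
  qed
qed

section \<open>Existence, uniqueness and analyticity up to exhaustion\<close>

theorem theorem4:
  fixes l :: nat and u0 :: "nat \<Rightarrow> real"
  assumes "1 \<le> l"
    and "\<forall>n\<in>{1..l}. 0 \<le> u0 n"
    and "(\<Sum>n = 1..l. u0 n) = 1"
  shows "\<exists>(u :: real \<Rightarrow> nat \<Rightarrow> real) (t_ex :: ereal).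
     small_cluster_solution l u0 u t_ex \<and> t_ex = exhaustion_time l u t_ex \<and>
     (\<forall>v \<tau>. small_cluster_solution l u0 v \<tau> \<and> \<tau> = exhaustion_time l v \<tau> \<longrightarrow> \<tau> = t_ex) \<and>
     (\<forall>v. small_cluster_solution l u0 v t_ex \<longrightarrow>
        (\<forall>t. 0 \<le> t \<and> ereal t < t_ex \<longrightarrow> (\<forall>n\<in>{1..l}. v t n = u t n))) \<and>
     (\<forall>n\<in>{1..l}. real_analytic_on (\<lambda>t. u t n) {t. 0 \<le> t \<and> ereal t < t_ex})"
proof (cases "M l u0 = 0")
  case True
  \<comment> \<open>Exhaustion is immediate: the interval is empty, so the differential equation,
    agreement on the interval and analyticity hold vacuously and only the end point matters.\<close>
  have empty: "\<not> ereal t < 0" if "0 \<le> t" for t using that by simp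
  have sol: "small_cluster_solution l u0 (\<lambda>_. u0) 0"
    unfolding small_cluster_solution_def using empty by (metis less_imp_le)
  show ?thesis
  proof (intro exI[of _ "\<lambda>_. u0"] exI[of _ 0] conjI allI impI ballI)
    show "0 = exhaustion_time l (\<lambda>_. u0) 0"
      using exhaustion_time_degenerate[OF sol True] by blast
    show "\<tau> = 0" if "small_cluster_solution l u0 v \<tau> \<and> \<tau> = exhaustion_time l v \<tau>" for v \<tau>
      using exhaustion_time_degenerate[OF _ True] that by blast
  qed (use sol in \<open>auto simp: real_analytic_on_def dest: empty\<close>)
next
  case False
  obtain u \<tau> where \<tau>: "0 < \<tau>" and sol: "small_cluster_solution l u0 u (ereal \<tau>)"
    and lim: "M_left_limit_zero l u \<tau>"
    and ana: "\<forall>n\<in>{1..l}. real_analytic_on (\<lambda>t. u t n) {0..<\<tau>}"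
    by (rule solution_exists[OF assms False])
  have exh: "ereal \<tau> = exhaustion_time l u (ereal \<tau>)"
    using iffD2[OF exhaustion_time_characterization[OF sol False]] \<tau> lim by blast
  have S: "{t. 0 \<le> t \<and> ereal t < ereal \<tau>} = {0..<\<tau>}" by auto
  show ?thesis
  proof (intro exI[of _ u] exI[of _ "ereal \<tau>"] conjI allI impI ballI)
    \<comment> \<open>Neither of two exhausted solutions can outlive the other, so their end points
      coincide.\<close>
    show "\<sigma> = ereal \<tau>" if "small_cluster_solution l u0 v \<sigma> \<and> \<sigma> = exhaustion_time l v \<sigma>" for v \<sigma>
    proof (rule antisym)
      show "\<sigma> \<le> ereal \<tau>"
        using exhausted_solution_not_extendable[OF sol exh _ False] that by blast
      show "ereal \<tau> \<le> \<sigma>"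
        using exhausted_solution_not_extendable[OF _ _ sol False] that by blast
    qed
    show "v t n = u t n"
      if "small_cluster_solution l u0 v (ereal \<tau>)" "0 \<le> t \<and> ereal t < ereal \<tau>" "n \<in> {1..l}" for v t n
      using solution_agree[OF that(1) sol] that by blast
    show "real_analytic_on (\<lambda>t. u t n) {t. 0 \<le> t \<and> ereal t < ereal \<tau>}" if "n \<in> {1..l}" for n
      unfolding S using ana that by blast
  qed (rule sol exh)+
qed

end
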